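(* Let $X$ and $Z$ be random variables with values in separable metric spaces $\mathcal{H}$ and $\mathcal{H}'$, respectively, and let $Y$ be a categorical random variable with levels $\{1,\ldots,K\}$ such that $\psi(X,Y)\ne1$. Define $$\psi(Z,Y\mid X)=\frac{\psi((X,Z),Y)-\psi(X,Y)}{1-\psi(X,Y)}.$$ Then: (M1') $0\le\psi(Z,Y\mid X)\le1$; (M2') $\psi(Z,Y\mid X)=0$ if and only if $Z$ and $Y$ are independent conditionally on $X$; (M3') $\psi(Z,Y\mid X)=1$ if and only if there is a measurable function $h$ such that $Y=h(X,Z)$ almost surely. Moreover, $\psi(Z,Y\mid X)=\psi(Z,\ell(Y)\mid X)$ for every $\ell\in\mathcal{L}_Y$.
   Context: $K\ge2$ and $p_k=P(Y=k)>0$ for all $k$. $\mathcal{L}_Y$ is the set of bijections from the set of levels of $Y$ onto $\{1,\ldots,K\}$. The pair $(X,Z)$ takes values in the separable metric space $\mathcal{H}\times\mathcal{H}'$. For a random variable $T$ with values in a separable metric space, $\psi(T,Y)$ is defined as follows: let $Q_k(T)=P(Y=k\mid T)$, $f(t,u)=\min\{k\in\{1,\ldots,K\}:\sum_{j=1}^kQ_j(t)>u\}$, let $U,U'$ be uniform on $(0,1)$ with $T,U,U'$ independent, and put $\widetilde Y=f(T,U)$ (so that $(\widetilde Y,T)$ has the law of $(Y,T)$) and $Y'=f(T,U')$. With $p_{i,j}=P(\widetilde Y=i,Y'=j)$, $$\psi(T,Y)=\frac1{K-1}\sum_{i,j=1}^K\frac{(p_{i,j}-p_ip_j)^2}{p_ip_j}.$$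 Here $p_{i,j}-p_ip_j=\mathrm{Cov}(Q_i(T),Q_j(T))$. *)

theory Defs
  imports "HOL-Probability.Probability"
begin

definition rv_sigma :: "'a measure \<Rightarrow> 'h measure \<Rightarrow> ('a \<Rightarrow> 'h) \<Rightarrow> 'a measure" where
  "rv_sigma M N T = vimage_algebra (space M) T N"

definition event_prob_given :: "'a measure \<Rightarrow> 'a measure \<Rightarrow> 'a set \<Rightarrow> 'a \<Rightarrow> real" where
  "event_prob_given M F A = real_cond_exp M F (indicator A)"

(* A Borel function on the value space of T whose composition with T is a version of P(Y = k | T).
   Such a function exists (level_prob_exists below) and is unique up to null sets of the law of T,
   so psi does not depend on the choice. *)
definition level_prob ::
  "'a measure \<Rightarrow> ('a \<Rightarrow> 'h::topological_space) \<Rightarrow> ('a \<Rightarrow> nat) \<Rightarrow> nat \<Rightarrow> 'h \<Rightarrow> real" where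
  "level_prob M T Y k = (SOME q. q \<in> borel_measurable borel \<and>
     (AE \<omega> in M. q (T \<omega>) =
        event_prob_given M (rv_sigma M borel T) {\<omega> \<in> space M. Y \<omega> = k} \<omega>))"

(* For u < 1 the minimum is over a nonempty set, outside a null set of t. *)
definition draw_level :: "nat \<Rightarrow> (nat \<Rightarrow> 'h \<Rightarrow> real) \<Rightarrow> 'h \<Rightarrow> real \<Rightarrow> nat" where
  "draw_level K Q t u = (LEAST k. k \<in> {1..K} \<and> (\<Sum>j=1..k. Q j t) > u)"

definition unit_uniform :: "real measure" where
  "unit_uniform = uniform_measure lborel {0<..<1}"

(* The original space extended by U and U', the two coordinates after \<omega>: they are uniform
   and independent of each other and of everything defined on M, in particular of T. *)
definition extended_space :: "'a measure \<Rightarrow> ('a \<times> real \<times> real) measure" where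
  "extended_space M = M \<Otimes>\<^sub>M (unit_uniform \<Otimes>\<^sub>M unit_uniform)"

definition joint_level_prob ::
  "'a measure \<Rightarrow> nat \<Rightarrow> ('a \<Rightarrow> 'h::topological_space) \<Rightarrow> ('a \<Rightarrow> nat) \<Rightarrow> nat \<Rightarrow> nat \<Rightarrow> real" where
  "joint_level_prob M K T Y i j = measure (extended_space M)
     {(\<omega>, u, u') \<in> space (extended_space M).
        draw_level K (level_prob M T Y) (T \<omega>) u = i \<and>
        draw_level K (level_prob M T Y) (T \<omega>) u' = j}"

definition marginal_level_prob :: "'a measure \<Rightarrow> ('a \<Rightarrow> nat) \<Rightarrow> nat \<Rightarrow> real" where
  "marginal_level_prob M Y k = measure M {\<omega> \<in> space M. Y \<omega> = k}"

definition psi ::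
  "'a measure \<Rightarrow> nat \<Rightarrow> ('a \<Rightarrow> 'h::topological_space) \<Rightarrow> ('a \<Rightarrow> nat) \<Rightarrow> real" where
  "psi M K T Y = 1 / (real K - 1) *
     (\<Sum>i=1..K. \<Sum>j=1..K.
        (joint_level_prob M K T Y i j - marginal_level_prob M Y i * marginal_level_prob M Y j)\<^sup>2
        / (marginal_level_prob M Y i * marginal_level_prob M Y j))"

(* psi(Z, Y | X); the argument order is Z, Y, X. *)
definition cond_psi ::
  "'a measure \<Rightarrow> nat \<Rightarrow> ('a \<Rightarrow> 'z::topological_space) \<Rightarrow> ('a \<Rightarrow> nat) \<Rightarrow>
   ('a \<Rightarrow> 'h::topological_space) \<Rightarrow> real" where
  "cond_psi M K Z Y X =
     (psi M K (\<lambda>\<omega>. (X \<omega>, Z \<omega>)) Y - psi M K X Y) / (1 - psi M K X Y)"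

definition cond_indep_rv ::
  "'a measure \<Rightarrow> 'z measure \<Rightarrow> ('a \<Rightarrow> 'z) \<Rightarrow> 'y measure \<Rightarrow> ('a \<Rightarrow> 'y) \<Rightarrow>
   'x measure \<Rightarrow> ('a \<Rightarrow> 'x) \<Rightarrow> bool" where
  "cond_indep_rv M NZ Z NY Y NX X \<longleftrightarrow>
     (\<forall>A \<in> sets NZ. \<forall>B \<in> sets NY. AE \<omega> in M.
        event_prob_given M (rv_sigma M NX X) {\<omega> \<in> space M. Z \<omega> \<in> A \<and> Y \<omega> \<in> B} \<omega> =
        event_prob_given M (rv_sigma M NX X) {\<omega> \<in> space M. Z \<omega> \<in> A} \<omega> *
        event_prob_given M (rv_sigma M NX X) {\<omega> \<in> space M. Y \<omega> \<in> B} \<omega>)"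

lemma factor_through_nn:
  fixes g :: "'a \<Rightarrow> ennreal"
  assumes T: "T \<in> \<Omega> \<rightarrow> space N" and g: "g \<in> borel_measurable (vimage_algebra \<Omega> T N)"
  shows "\<exists>h. h \<in> borel_measurable N \<and> (\<forall>\<omega>\<in>\<Omega>. g \<omega> = h (T \<omega>))"
  using g
proof (induction rule: borel_measurable_induct)
  case (cong f g)
  then show ?case by simp
next
  case (set A)
  then obtain B where B: "B \<in> sets N" "A = T -` B \<inter> \<Omega>"
    unfolding sets_vimage_algebra2[OF T] by blast
  have "\<forall>\<omega>\<in>\<Omega>. indicator A \<omega> = (indicator B (T \<omega>) :: ennreal)"
    unfolding B(2) by (simp add: indicator_def)
  with B(1) show ?case
    by (intro exI[of _ "indicator B"]) simp
next
  case (mult u c)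
  then obtain h where "h \<in> borel_measurable N" "\<forall>\<omega>\<in>\<Omega>. u \<omega> = h (T \<omega>)" by blast
  then show ?case by (intro exI[of _ "\<lambda>t. c * h t"]) simp
next
  case (add u v)
  then obtain h h' where "h \<in> borel_measurable N" "\<forall>\<omega>\<in>\<Omega>. u \<omega> = h (T \<omega>)"
    "h' \<in> borel_measurable N" "\<forall>\<omega>\<in>\<Omega>. v \<omega> = h' (T \<omega>)" by blast
  then show ?case by (intro exI[of _ "\<lambda>t. h' t + h t"]) simp
next
  case (seq U)
  have "\<forall>i. \<exists>h. h \<in> borel_measurable N \<and> (\<forall>\<omega>\<in>\<Omega>. U i \<omega> = h (T \<omega>))"
    using seq by blast
  from choice[OF this] obtain h where
    h: "\<And>i. h i \<in> borel_measurable N" "\<And>i. \<forall>\<omega>\<in>\<Omega>. U i \<omega> = h i (T \<omega>)"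
    by blast
  have "(\<lambda>t. SUP i. h i t) \<in> borel_measurable N"
    by (rule borel_measurable_SUP) (simp_all add: h(1))
  moreover have "\<forall>\<omega>\<in>\<Omega>. (SUP i. U i) \<omega> = (SUP i. h i (T \<omega>))"
    using h(2) by (simp add: image_comp comp_def)
  ultimately show ?case
    by (intro exI[of _ "\<lambda>t. SUP i. h i t"]) blast
qed

lemma factor_through_real:
  fixes g :: "'a \<Rightarrow> real"
  assumes T: "T \<in> \<Omega> \<rightarrow> space N" and g: "g \<in> borel_measurable (vimage_algebra \<Omega> T N)"
  shows "\<exists>h. h \<in> borel_measurable N \<and> (\<forall>\<omega>\<in>\<Omega>. g \<omega> = h (T \<omega>))"
proof -
  have 1: "(\<lambda>\<omega>. ennreal (g \<omega>)) \<in> borel_measurable (vimage_algebra \<Omega> T N)"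
    using g by measurable
  have 2: "(\<lambda>\<omega>. ennreal (- g \<omega>)) \<in> borel_measurable (vimage_algebra \<Omega> T N)"
    using g by measurable
  obtain h where h: "h \<in> borel_measurable N" "\<forall>\<omega>\<in>\<Omega>. ennreal (g \<omega>) = h (T \<omega>)"
    using factor_through_nn[OF T 1] by blast
  obtain h' where h': "h' \<in> borel_measurable N" "\<forall>\<omega>\<in>\<Omega>. ennreal (- g \<omega>) = h' (T \<omega>)"
    using factor_through_nn[OF T 2] by blast
  have split: "x = enn2real (ennreal x) - enn2real (ennreal (- x))" for x :: real
    by (cases "x \<ge> 0") (simp_all add: ennreal_neg)
  have "\<forall>\<omega>\<in>\<Omega>. g \<omega> = enn2real (h (T \<omega>)) - enn2real (h' (T \<omega>))"
  proof
    fix \<omega> assume "\<omega> \<in> \<Omega>"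
    then show "g \<omega> = enn2real (h (T \<omega>)) - enn2real (h' (T \<omega>))"
      using split[of "g \<omega>"] h(2) h'(2) by metis
  qed
  moreover have "(\<lambda>t. enn2real (h t) - enn2real (h' t)) \<in> borel_measurable N"
    using h(1) h'(1) by measurable
  ultimately show ?thesis
    by (intro exI[of _ "\<lambda>t. enn2real (h t) - enn2real (h' t)"]) blast
qed

lemma level_prob_exists:
  shows "level_prob M T Y k \<in> borel_measurable borel"
    and "AE \<omega> in M. level_prob M T Y k (T \<omega>) =
           event_prob_given M (rv_sigma M borel T) {\<omega> \<in> space M. Y \<omega> = k} \<omega>"
proof -
  let ?c = "event_prob_given M (rv_sigma M borel T) {\<omega> \<in> space M. Y \<omega> = k}"
  have T: "T \<in> space M \<rightarrow> space borel" by simp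
  have "?c \<in> borel_measurable (vimage_algebra (space M) T borel)"
    unfolding event_prob_given_def rv_sigma_def by (rule borel_measurable_cond_exp)
  from factor_through_real[OF T this] obtain h where
    h: "h \<in> borel_measurable borel" "\<forall>\<omega>\<in>space M. ?c \<omega> = h (T \<omega>)" by (elim exE conjE)
  have "AE \<omega> in M. h (T \<omega>) = ?c \<omega>"
    by (rule AE_I2) (simp only: h(2))
  with h(1) have "\<exists>q. q \<in> borel_measurable borel \<and> (AE \<omega> in M. q (T \<omega>) = ?c \<omega>)"
    by (intro exI[of _ h] conjI)
  from someI_ex[OF this]
  have "level_prob M T Y k \<in> borel_measurable borel \<and>
      (AE \<omega> in M. level_prob M T Y k (T \<omega>) = ?c \<omega>)"
    unfolding level_prob_def .
  then show "level_prob M T Y k \<in> borel_measurable borel"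
    and "AE \<omega> in M. level_prob M T Y k (T \<omega>) = ?c \<omega>"
    by (rule conjunct1, rule conjunct2)
qed

end

theory Submission
  imports Defs
begin

text \<open>
  Write \<open>Q\<^sub>T\<close> for the vector of conditional level probabilities given \<open>T\<close> and \<open>p\<close> for the level
  probabilities. Up to the factor \<open>K - 1\<close>, \<open>\<psi>(T, Y)\<close> is the squared Frobenius norm of the covariance
  matrix of \<open>Q\<^sub>T\<close>, weighted by \<open>1 / (p\<^sub>i p\<^sub>j)\<close>. Adding an uncorrelated vector adds a positive semidefinite
  matrix to the covariance, and the trace of a product of two such matrices is nonnegative, so the
  squared norm grows by at least the squared norm of the summand's covariance. With
  \<open>W = (X, Z)\<close>, along the martingale
  \<open>Q\<^sub>X\<close>, \<open>Q\<^sub>W\<close>, \<open>(1{Y = k})\<^sub>k\<close> this gives \<open>\<psi>(X, Y) \<le> \<psi>(W, Y) \<le> 1\<close>; equality on the left means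
  \<open>Q\<^sub>X = Q\<^sub>W\<close> almost surely, which is conditional independence, and equality on the right means
  that \<open>Q\<^sub>W\<close> is the indicator vector of \<open>Y\<close>.
\<close>

subsection \<open>Weighted Frobenius norms of Gram matrices\<close>

text \<open>With G the matrix of inner products of the \<open>f i\<close> in L2(\<open>M\<close>)
  and D = diag(w), this is the squared Frobenius norm of D^(-1/2) G D^(-1/2) when the weights are
  positive. For centred \<open>f i\<close>, G is the covariance matrix.\<close>

definition gram_energy :: "'a measure \<Rightarrow> 'i set \<Rightarrow> ('i \<Rightarrow> real) \<Rightarrow> ('i \<Rightarrow> 'a \<Rightarrow> real) \<Rightarrow> real" where
  "gram_energy M I w f =
     (\<Sum>i\<in>I. \<Sum>j\<in>I. (\<integral>\<omega>. f i \<omega> * f j \<omega> \<partial>M)\<^sup>2 / (w i * w j))"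

text \<open>The quadratic form of a Gram matrix at c is the integral of the square of the
  combination of the \<open>r i\<close> with coefficients \<open>c i\<close>.\<close>

lemma gram_matrix_nonneg:
  fixes r :: "'i \<Rightarrow> 'a \<Rightarrow> real"
  assumes "\<And>i j. i \<in> I \<Longrightarrow> j \<in> I \<Longrightarrow> integrable M (\<lambda>\<omega>. r i \<omega> * r j \<omega>)"
  shows "0 \<le> (\<Sum>i\<in>I. \<Sum>j\<in>I. c i * c j * (\<integral>\<omega>. r i \<omega> * r j \<omega> \<partial>M))"
proof -
  have "(\<Sum>i\<in>I. \<Sum>j\<in>I. c i * c j * (\<integral>\<omega>. r i \<omega> * r j \<omega> \<partial>M)) =
      (\<integral>\<omega>. (\<Sum>i\<in>I. \<Sum>j\<in>I. c i * c j * (r i \<omega> * r j \<omega>)) \<partial>M)"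
    using assms by simp
  also have "\<dots> = (\<integral>\<omega>. (\<Sum>i\<in>I. c i * r i \<omega>)\<^sup>2 \<partial>M)"
    by (simp add: power2_eq_square sum_product algebra_simps)
  finally show ?thesis
    by simp
qed

text \<open>Freeze \<open>a\<close> at a point \<open>\<omega>\<close>, apply the previous lemma to \<open>r\<close> with \<open>c i = a i \<omega> / w i\<close>, and
  integrate over \<open>\<omega>\<close>.\<close>

lemma gram_matrices_inner_nonneg:
  fixes a r :: "'i \<Rightarrow> 'a \<Rightarrow> real"
  assumes a: "\<And>i j. i \<in> I \<Longrightarrow> j \<in> I \<Longrightarrow> integrable M (\<lambda>\<omega>. a i \<omega> * a j \<omega>)"
    and r: "\<And>i j. i \<in> I \<Longrightarrow> j \<in> I \<Longrightarrow> integrable M (\<lambda>\<omega>. r i \<omega> * r j \<omega>)"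
  shows "0 \<le> (\<Sum>i\<in>I. \<Sum>j\<in>I.
    (\<integral>\<omega>. a i \<omega> * a j \<omega> \<partial>M) * (\<integral>\<omega>. r i \<omega> * r j \<omega> \<partial>M) / (w i * w j))"
proof -
  define R where "R i j = (\<integral>\<omega>. r i \<omega> * r j \<omega> \<partial>M)" for i j
  have "(\<Sum>i\<in>I. \<Sum>j\<in>I. (\<integral>\<omega>. a i \<omega> * a j \<omega> \<partial>M) * R i j / (w i * w j)) =
      (\<integral>\<omega>. (\<Sum>i\<in>I. \<Sum>j\<in>I. (a i \<omega> * a j \<omega>) * (R i j / (w i * w j))) \<partial>M)"
    using a by (simp del: times_divide_eq_right) simp
  also have "\<dots> = (\<integral>\<omega>. (\<Sum>i\<in>I. \<Sum>j\<in>I. a i \<omega> / w i * (a j \<omega> / w j) * R i j) \<partial>M)"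
    by simp
  also have "\<dots> \<ge> 0"
    unfolding R_def by (intro Bochner_Integration.integral_nonneg gram_matrix_nonneg r)
  finally show ?thesis
    unfolding R_def .
qed

text \<open>Orthogonality of every \<open>a i\<close> to every \<open>r j\<close> makes the Gram
  matrix of the sum equal to A + R. Expanding the squares entrywise leaves the two energies and
  twice the weighted inner product of A and R, which is nonnegative by the previous lemma.\<close>

lemma gram_energy_orthogonal_sum:
  fixes a r :: "'i \<Rightarrow> 'a \<Rightarrow> real"
  assumes a: "\<And>i j. i \<in> I \<Longrightarrow> j \<in> I \<Longrightarrow> integrable M (\<lambda>\<omega>. a i \<omega> * a j \<omega>)"
    and r: "\<And>i j. i \<in> I \<Longrightarrow> j \<in> I \<Longrightarrow> integrable M (\<lambda>\<omega>. r i \<omega> * r j \<omega>)"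
    and ar: "\<And>i j. i \<in> I \<Longrightarrow> j \<in> I \<Longrightarrow> integrable M (\<lambda>\<omega>. a i \<omega> * r j \<omega>)"
    and orth: "\<And>i j. i \<in> I \<Longrightarrow> j \<in> I \<Longrightarrow> (\<integral>\<omega>. a i \<omega> * r j \<omega> \<partial>M) = 0"
  shows "gram_energy M I w a + gram_energy M I w r \<le> gram_energy M I w (\<lambda>i \<omega>. a i \<omega> + r i \<omega>)"
proof -
  let ?A = "\<lambda>i j. \<integral>\<omega>. a i \<omega> * a j \<omega> \<partial>M" and ?R = "\<lambda>i j. \<integral>\<omega>. r i \<omega> * r j \<omega> \<partial>M"
  have "(\<integral>\<omega>. (a i \<omega> + r i \<omega>) * (a j \<omega> + r j \<omega>) \<partial>M) = ?A i j + ?R i j"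
    if "i \<in> I" "j \<in> I" for i j
  proof -
    have "(\<integral>\<omega>. (a i \<omega> + r i \<omega>) * (a j \<omega> + r j \<omega>) \<partial>M) =
        (\<integral>\<omega>. a i \<omega> * a j \<omega> + a i \<omega> * r j \<omega> + (a j \<omega> * r i \<omega> + r i \<omega> * r j \<omega>) \<partial>M)"
      by (simp add: algebra_simps)
    also have "\<dots> = ?A i j + (\<integral>\<omega>. a i \<omega> * r j \<omega> \<partial>M) + ((\<integral>\<omega>. a j \<omega> * r i \<omega> \<partial>M) + ?R i j)"
      using a ar r that by simp
    finally show ?thesis
      using orth that by simp
  qed
  then have "gram_energy M I w (\<lambda>i \<omega>. a i \<omega> + r i \<omega>) =
      (\<Sum>i\<in>I. \<Sum>j\<in>I. (?A i j + ?R i j)\<^sup>2 / (w i * w j))"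
    unfolding gram_energy_def by simp
  also have "\<dots> = gram_energy M I w a + gram_energy M I w r +
      2 * (\<Sum>i\<in>I. \<Sum>j\<in>I. ?A i j * ?R i j / (w i * w j))"
    unfolding gram_energy_def
    by (simp add: power2_sum add_divide_distrib sum.distrib sum_distrib_left mult.assoc)
  finally show ?thesis
    using gram_matrices_inner_nonneg[of I M a r w] a r by simp
qed

lemma gram_energy_nonneg:
  assumes "\<And>i. i \<in> I \<Longrightarrow> 0 < w i"
  shows "0 \<le> gram_energy M I w f"
  unfolding gram_energy_def using assms
  by (intro sum_nonneg divide_nonneg_pos) auto

text \<open>All terms of the energy are nonnegative, so each diagonal term is bounded by the whole.
  It therefore vanishes, and with it the L2 norm of \<open>f i\<close>. This serves the equality
  cases.\<close>

lemma gram_energy_le_0_imp_AE_0: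
  assumes w: "\<And>i. i \<in> I \<Longrightarrow> 0 < w i" and I: "finite I"
    and f: "\<And>i. i \<in> I \<Longrightarrow> integrable M (\<lambda>\<omega>. f i \<omega> * f i \<omega>)"
    and le: "gram_energy M I w f \<le> 0" and i: "i \<in> I"
  shows "AE \<omega> in M. f i \<omega> = 0"
proof -
  have pos: "0 \<le> (\<integral>\<omega>. f i \<omega> * f j \<omega> \<partial>M)\<^sup>2 / (w i * w j)" if "i \<in> I" "j \<in> I" for i j
    using w that by (intro divide_nonneg_pos) auto
  have "(\<integral>\<omega>. f i \<omega> * f i \<omega> \<partial>M)\<^sup>2 / (w i * w i) \<le> (\<Sum>j\<in>I. (\<integral>\<omega>. f i \<omega> * f j \<omega> \<partial>M)\<^sup>2 / (w i * w j))"
    using I i pos by (intro member_le_sum) auto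
  also have "\<dots> \<le> gram_energy M I w f"
    unfolding gram_energy_def using I i pos
    by (intro member_le_sum[of i I "\<lambda>i. \<Sum>j\<in>I. (\<integral>\<omega>. f i \<omega> * f j \<omega> \<partial>M)\<^sup>2 / (w i * w j)"] sum_nonneg) auto
  also note le
  finally have "(\<integral>\<omega>. f i \<omega> * f i \<omega> \<partial>M) = 0"
    using mult_pos_pos[OF w[OF i] w[OF i]] by (simp add: divide_le_0_iff)
  then have "AE \<omega> in M. f i \<omega> * f i \<omega> = 0"
    using f[OF i] by (subst (asm) integral_nonneg_eq_0_iff_AE) auto
  then show ?thesis by simp
qed

lemma gram_energy_reindex:
  assumes "bij_betw l I J"
  shows "gram_energy M J w f = gram_energy M I (w \<circ> l) (f \<circ> l)"
  unfolding gram_energy_def by (simp add: sum.reindex_bij_betw[OF assms, symmetric])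

lemma gram_energy_cong:
  assumes "\<And>i. i \<in> I \<Longrightarrow> w i = w' i" "\<And>i. i \<in> I \<Longrightarrow> f i = f' i"
  shows "gram_energy M I w f = gram_energy M I w' f'"
  unfolding gram_energy_def using assms by (intro sum.cong refl) simp

lemma gram_energy_cong_AE:
  assumes "\<And>i. i \<in> I \<Longrightarrow> f i \<in> borel_measurable M" "\<And>i. i \<in> I \<Longrightarrow> g i \<in> borel_measurable M"
    and "\<And>i. i \<in> I \<Longrightarrow> AE \<omega> in M. f i \<omega> = g i \<omega>"
  shows "gram_energy M I w f = gram_energy M I w g"
  unfolding gram_energy_def
proof (intro sum.cong refl arg_cong2[where f="(/)"] arg_cong[where f="\<lambda>x. x\<^sup>2"])
  fix i j assume ij: "i \<in> I" "j \<in> I"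
  have "AE \<omega> in M. f i \<omega> * f j \<omega> = g i \<omega> * g j \<omega>"
    using assms(3)[OF ij(1)] assms(3)[OF ij(2)] by eventually_elim simp
  then show "(\<integral>\<omega>. f i \<omega> * f j \<omega> \<partial>M) = (\<integral>\<omega>. g i \<omega> * g j \<omega> \<partial>M)"
    using assms(1,2) ij by (intro integral_cong_AE) auto
qed

subsection \<open>Drawing levels with uniform variables\<close>

lemma prob_space_unit_uniform: "prob_space unit_uniform"
  unfolding unit_uniform_def by (rule prob_space_uniform_measure) auto

text \<open>Nonnegativity makes the partial sums nondecreasing, so the first one to exceed u is the
  i-th exactly when u lies in the i-th half-open interval of the partition of [0, 1) that they
  define.\<close>

lemma draw_level_eq_iff:
  assumes nonneg: "\<And>k. k \<in> {1..K} \<Longrightarrow> 0 \<le> Q k t" and total: "(\<Sum>k=1..K. Q k t) = 1"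
    and u: "0 < u" "u < 1" and i: "i \<in> {1..K}"
  shows "draw_level K Q t u = i \<longleftrightarrow> (\<Sum>j=1..i-1. Q j t) \<le> u \<and> u < (\<Sum>j=1..i. Q j t)"
proof
  let ?P = "\<lambda>k. k \<in> {1..K} \<and> u < (\<Sum>j=1..k. Q j t)"
  \<comment> \<open>The full sum is 1 and exceeds u, so the minimum is over a nonempty set.\<close>
  have "?P K" using total u i by auto
  then have P: "?P (LEAST k. ?P k)" by (rule LeastI)
  assume "draw_level K Q t u = i"
  then have eq: "(LEAST k. ?P k) = i" unfolding draw_level_def by auto
  moreover have "(\<Sum>j=1..i-1. Q j t) \<le> u"
  \<comment> \<open>For i = 1 the sum is empty and the bound is 0 < u; otherwise i - 1 is a level
    that minimality excludes.\<close>
  proof (cases "i = 1")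
    case False
    then have "\<not> ?P (i - 1)" using i eq not_less_Least[of "i - 1" ?P] by simp
    then show ?thesis using False i by auto
  qed (use u in simp)
  ultimately show "(\<Sum>j=1..i-1. Q j t) \<le> u \<and> u < (\<Sum>j=1..i. Q j t)" using P by simp
next
  assume *: "(\<Sum>j=1..i-1. Q j t) \<le> u \<and> u < (\<Sum>j=1..i. Q j t)"
  show "draw_level K Q t u = i"
    unfolding draw_level_def
  proof (rule Least_equality)
    fix k assume k: "k \<in> {1..K} \<and> u < (\<Sum>j=1..k. Q j t)"
    show "i \<le> k"
    proof (rule ccontr)
      assume "\<not> i \<le> k"
      then have "(\<Sum>j=1..k. Q j t) \<le> (\<Sum>j=1..i-1. Q j t)"
        using i nonneg by (intro sum_mono2) auto
      then show False using k * by linarith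
    qed
  qed (use i * in auto)
qed

text \<open>Inverse transform sampling: the values of u that draw level i fill an interval of length
  \<open>Q i t\<close>.\<close>

lemma emeasure_draw_level:
  assumes nonneg: "\<And>k. k \<in> {1..K} \<Longrightarrow> 0 \<le> Q k t" and total: "(\<Sum>k=1..K. Q k t) = 1"
    and i: "i \<in> {1..K}"
  shows "emeasure unit_uniform {u. draw_level K Q t u = i} = ennreal (Q i t)"
proof -
  define l where "l = (\<Sum>j=1..i-1. Q j t)"
  have step: "(\<Sum>j=1..i. Q j t) = l + Q i t"
    using i unfolding l_def by (cases i) auto
  have l: "0 \<le> l" unfolding l_def using i nonneg by (intro sum_nonneg) auto
  have "(\<Sum>j=1..i. Q j t) \<le> (\<Sum>k=1..K. Q k t)"
    using i nonneg by (intro sum_mono2) auto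
  then have le1: "l + Q i t \<le> 1" using step total by simp
  \<comment> \<open>The uniform variable lives on the open interval, so 0 drops out when l = 0, and
    \<open>le1\<close> keeps the right end within 1. The missing point is a null set.\<close>
  have eq: "{0<..<1} \<inter> {u. draw_level K Q t u = i} = {l..<l + Q i t} - {0}"
  proof (rule set_eqI)
    fix u
    show "u \<in> {0<..<1} \<inter> {u. draw_level K Q t u = i} \<longleftrightarrow> u \<in> {l..<l + Q i t} - {0}"
      using draw_level_eq_iff[of K Q t u i, OF nonneg total _ _ i] le1 l
      unfolding step l_def[symmetric] by auto
  qed
  have [measurable]: "{u. draw_level K Q t u = i} \<in> sets borel"
  proof -
    have [measurable]: "(\<lambda>u. draw_level K Q t u) \<in> borel \<rightarrow>\<^sub>M count_space UNIV"
      unfolding draw_level_def by measurable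
    show ?thesis by measurable
  qed
  have "emeasure unit_uniform {u. draw_level K Q t u = i} = emeasure lborel ({l..<l + Q i t} - {0})"
    unfolding unit_uniform_def by (subst emeasure_uniform_measure) (simp_all add: eq divide_ennreal_def)
  also have "\<dots> = emeasure lborel {l..<l + Q i t}"
    by (rule emeasure_Diff_null_set) auto
  finally show ?thesis using nonneg[OF i] by simp
qed

subsection \<open>Sigma-algebras generated by random variables\<close>

lemma subalgebra_rv_sigma:
  assumes "T \<in> M \<rightarrow>\<^sub>M N"
  shows "subalgebra M (rv_sigma M N T)"
  using assms unfolding subalgebra_def rv_sigma_def
  by (auto simp: sets_vimage_algebra2 measurable_space Pi_iff)

lemma measurable_compose_rv_sigma:
  assumes "T \<in> M \<rightarrow>\<^sub>M N" "g \<in> N \<rightarrow>\<^sub>M L"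
  shows "(\<lambda>\<omega>. g (T \<omega>)) \<in> rv_sigma M N T \<rightarrow>\<^sub>M L"
  using assms unfolding rv_sigma_def
  by (intro measurable_compose[OF measurable_vimage_algebra1]) (auto simp: measurable_space)

lemma sets_rv_sigma:
  assumes "T \<in> M \<rightarrow>\<^sub>M N"
  shows "sets (rv_sigma M N T) = {T -` B \<inter> space M |B. B \<in> sets N}"
  using assms unfolding rv_sigma_def by (intro sets_vimage_algebra2) (auto simp: measurable_space)

lemma (in prob_space) sigma_finite_subalgebra_rv_sigma:
  assumes "T \<in> M \<rightarrow>\<^sub>M N"
  shows "sigma_finite_subalgebra M (rv_sigma M N T)"
  using assms
  by (intro finite_measure_subalgebra_is_sigma_finite finite_measure_subalgebra.intro
      finite_measure_subalgebra_axioms.intro subalgebra_rv_sigma finite_measure_axioms)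

text \<open>A Dynkin system argument: rectangles are stable under intersection and generate the
  product sigma-algebra, and the sets over whose preimage f integrates to 0 are closed under
  complements and countable disjoint unions.\<close>

lemma (in finite_measure) set_integral_pair_eq_0I:
  fixes f :: "'a \<Rightarrow> real"
  assumes X: "X \<in> M \<rightarrow>\<^sub>M N" and Z: "Z \<in> M \<rightarrow>\<^sub>M L" and f: "integrable M f"
    and rect: "\<And>A B. A \<in> sets N \<Longrightarrow> B \<in> sets L \<Longrightarrow>
      (LINT \<omega>:{\<omega> \<in> space M. X \<omega> \<in> A \<and> Z \<omega> \<in> B}|M. f \<omega>) = 0"
    and S: "S \<in> sets (N \<Otimes>\<^sub>M L)"
  shows "(LINT \<omega>:{\<omega> \<in> space M. (X \<omega>, Z \<omega>) \<in> S}|M. f \<omega>) = 0"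
proof -
  note [measurable] = X Z
  have int: "set_integrable M A f" if "A \<in> sets M" for A
    using f that unfolding set_integrable_def by (rule integrable_mult_indicator[rotated])
  \<comment> \<open>The whole space is the preimage of a rectangle; the complement case subtracts
    from this integral.\<close>
  have whole: "(LINT \<omega>:space M|M. f \<omega>) = 0"
  proof -
    have "{\<omega> \<in> space M. X \<omega> \<in> space N \<and> Z \<omega> \<in> space L} = space M"
      using measurable_space[OF X] measurable_space[OF Z] by auto
    then show ?thesis using rect[of "space N" "space L"] by simp
  qed
  have gen: "{a \<times> b |a b. a \<in> sets N \<and> b \<in> sets L} \<subseteq> Pow (space N \<times> space L)"
    by (rule pair_measure_closed)
  show ?thesis
    using Int_stable_pair_measure_generator gen S[unfolded sets_pair_measure]
  proof (induction rule: sigma_sets_induct_disjoint)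
    case (basic S)
    then show ?case using rect by auto
  next
    case empty
    then show ?case by (simp add: set_lebesgue_integral_def)
  next
    case (compl S)
    have [measurable]: "S \<in> sets (N \<Otimes>\<^sub>M L)"
      using compl(1) by (simp add: sets_pair_measure)
    let ?A = "{\<omega> \<in> space M. (X \<omega>, Z \<omega>) \<in> S}" and ?B = "{\<omega> \<in> space M. (X \<omega>, Z \<omega>) \<in> space N \<times> space L - S}"
    have "?A \<union> ?B = space M"
      using measurable_space[OF X] measurable_space[OF Z] by auto
    moreover have "(LINT \<omega>:?A \<union> ?B|M. f \<omega>) = (LINT \<omega>:?A|M. f \<omega>) + (LINT \<omega>:?B|M. f \<omega>)"
      by (intro set_integral_Un int) (auto simp: space_pair_measure[symmetric])
    ultimately show ?case using whole compl(2) by simp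
  next
    case (union S)
    have [measurable]: "S i \<in> sets (N \<Otimes>\<^sub>M L)" for i
      using union(2) by (auto simp: sets_pair_measure)
    let ?A = "\<lambda>i. {\<omega> \<in> space M. (X \<omega>, Z \<omega>) \<in> S i}"
    have "(LINT \<omega>:(\<Union>i. ?A i)|M. f \<omega>) = (\<Sum>i. LINT \<omega>:?A i|M. f \<omega>)"
      using union(1) by (intro lebesgue_integral_countable_add int) (auto simp: disjoint_family_on_def)
    moreover have "(\<Union>i. ?A i) = {\<omega> \<in> space M. (X \<omega>, Z \<omega>) \<in> (\<Union>i. S i)}"
      by auto
    ultimately show ?case using union(3) by simp
  qed
qed

lemma (in finite_measure) integrable_bounded_mult:
  fixes f g :: "'a \<Rightarrow> real"
  assumes [measurable]: "f \<in> borel_measurable M" "g \<in> borel_measurable M"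
    and "AE \<omega> in M. \<bar>f \<omega>\<bar> \<le> 1" "AE \<omega> in M. \<bar>g \<omega>\<bar> \<le> 1"
  shows "integrable M (\<lambda>\<omega>. f \<omega> * g \<omega>)"
proof -
  have "AE \<omega> in M. norm (f \<omega> * g \<omega>) \<le> 1"
    using assms(3,4) by eventually_elim (simp add: abs_mult mult_le_one)
  then show ?thesis by (intro integrable_const_bound) auto
qed

subsection \<open>Conditional level probabilities\<close>

locale categorical_rv = prob_space M for M :: "'a measure" +
  fixes K :: nat and Y :: "'a \<Rightarrow> nat"
  assumes K: "2 \<le> K"
    and Y: "Y \<in> M \<rightarrow>\<^sub>M count_space {1..K}"
    and pos: "\<And>k. k \<in> {1..K} \<Longrightarrow> 0 < marginal_level_prob M Y k"
begin

abbreviation p where "p \<equiv> marginal_level_prob M Y"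

abbreviation level :: "nat \<Rightarrow> 'a \<Rightarrow> real" where
  "level k \<equiv> indicator {\<omega> \<in> space M. Y \<omega> = k}"

text \<open>A version of P(Y = k | T), viewed as a random variable on the original space so that it
  can be compared with \<open>level k\<close> and with versions for other conditioning
  variables.\<close>

abbreviation post :: "('a \<Rightarrow> 'h::topological_space) \<Rightarrow> nat \<Rightarrow> 'a \<Rightarrow> real" where
  "post T k \<omega> \<equiv> level_prob M T Y k (T \<omega>)"

lemma level_sets [measurable]: "{\<omega> \<in> space M. Y \<omega> = k} \<in> sets M"
proof -
  have "{\<omega> \<in> space M. Y \<omega> = k} = Y -` ({k} \<inter> {1..K}) \<inter> space M"
    using measurable_space[OF Y] by auto
  then show ?thesis using measurable_sets[OF Y, of "{k} \<inter> {1..K}"] by (simp del: vimage_Int)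
qed

lemma sum_level: "\<omega> \<in> space M \<Longrightarrow> (\<Sum>k=1..K. level k \<omega>) = 1"
proof -
  assume "\<omega> \<in> space M"
  then have "(\<Sum>k=1..K. level k \<omega>) = (\<Sum>k=1..K. if Y \<omega> = k then 1 else 0)" "Y \<omega> \<in> {1..K}"
    using measurable_space[OF Y] by (simp_all add: indicator_def)
  then show ?thesis by simp
qed

lemma integral_level: "(\<integral>\<omega>. level k \<omega> \<partial>M) = p k"
  by (simp add: marginal_level_prob_def)

lemma integrable_level [simp]: "integrable M (level k)"
  by (intro integrable_const_bound[of _ 1]) auto

lemma integral_level_mult: "(\<integral>\<omega>. level i \<omega> * level j \<omega> \<partial>M) = (if i = j then p i else 0)"
proof -
  have "level i \<omega> * level j \<omega> = (if i = j then level i \<omega> else 0)" for \<omega>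
    by (auto simp: indicator_def)
  then show ?thesis by (simp add: marginal_level_prob_def)
qed

lemma sum_p: "(\<Sum>k=1..K. p k) = 1"
proof -
  have "(\<Sum>k=1..K. p k) = (\<integral>\<omega>. (\<Sum>k=1..K. level k \<omega>) \<partial>M)"
    by (simp add: marginal_level_prob_def)
  also have "\<dots> = (\<integral>\<omega>. 1 \<partial>M)"
    by (intro Bochner_Integration.integral_cong sum_level) auto
  finally show ?thesis by (simp add: prob_space)
qed

context
  fixes T :: "'a \<Rightarrow> 'h::topological_space"
  assumes T [measurable]: "T \<in> M \<rightarrow>\<^sub>M borel"
begin

interpretation F: sigma_finite_subalgebra M "rv_sigma M borel T"
  by (rule sigma_finite_subalgebra_rv_sigma[OF T])

lemma level_prob_borel [measurable]: "level_prob M T Y k \<in> borel_measurable borel"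
  by (rule level_prob_exists(1))

lemma borel_measurable_post [measurable]: "post T k \<in> borel_measurable M"
  using measurable_compose[OF T level_prob_borel] by simp

lemma post_eq: "AE \<omega> in M. post T k \<omega> = real_cond_exp M (rv_sigma M borel T) (level k) \<omega>"
  using level_prob_exists(2)[of M T Y k] unfolding event_prob_given_def .

lemma post_nonneg: "AE \<omega> in M. 0 \<le> post T k \<omega>"
proof -
  have "AE \<omega> in M. 0 \<le> real_cond_exp M (rv_sigma M borel T) (level k) \<omega>"
    by (intro F.real_cond_exp_pos) auto
  then show ?thesis using post_eq[of k] by eventually_elim simp
qed

lemma post_le_1: "AE \<omega> in M. post T k \<omega> \<le> 1"
proof -
  have "AE \<omega> in M. real_cond_exp M (rv_sigma M borel T) (level k) \<omega> \<le> 1"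
    by (intro F.real_cond_exp_le_c) (auto simp: indicator_def)
  then show ?thesis using post_eq[of k] by eventually_elim simp
qed

text \<open>The indicators of the levels sum to 1, and conditional expectation is linear. Together
  with nonnegativity this is what the law of \<open>draw_level\<close> requires.\<close>

lemma sum_post: "AE \<omega> in M. (\<Sum>k=1..K. post T k \<omega>) = 1"
proof -
  let ?E = "real_cond_exp M (rv_sigma M borel T)"
  have "AE \<omega> in M. \<forall>k\<in>{1..K}. post T k \<omega> = ?E (level k) \<omega>"
    using post_eq by (intro AE_ball_countable') auto
  moreover have "AE \<omega> in M. ?E (\<lambda>\<omega>. \<Sum>k=1..K. level k \<omega>) \<omega> = (\<Sum>k=1..K. ?E (level k) \<omega>)"
    by (intro F.real_cond_exp_sum) auto
  moreover have "AE \<omega> in M. ?E (\<lambda>\<omega>. \<Sum>k=1..K. level k \<omega>) \<omega> = ?E (\<lambda>\<omega>. 1) \<omega>"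
    by (intro F.real_cond_exp_cong AE_I2 sum_level) auto
  moreover have "AE \<omega> in M. ?E (\<lambda>\<omega>. 1) \<omega> = 1"
    by (intro F.real_cond_exp_F_meas) auto
  ultimately show ?thesis by eventually_elim simp
qed

text \<open>Since g(T) is measurable for the sigma-algebra of T, the conditional expectation inside
  the integral may be replaced by the indicator. All orthogonality relations below come from
  here.\<close>

lemma integral_mult_post:
  assumes g: "g \<in> borel_measurable borel" and int: "integrable M (\<lambda>\<omega>. g (T \<omega>))"
  shows "(\<integral>\<omega>. g (T \<omega>) * post T k \<omega> \<partial>M) = (\<integral>\<omega>. g (T \<omega>) * level k \<omega> \<partial>M)"
proof -
  note [measurable] = g
  let ?E = "real_cond_exp M (rv_sigma M borel T)"
  have "(\<integral>\<omega>. g (T \<omega>) * post T k \<omega> \<partial>M) = (\<integral>\<omega>. g (T \<omega>) * ?E (level k) \<omega> \<partial>M)"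
    using post_eq[of k] by (intro integral_cong_AE) auto
  also have "\<dots> = (\<integral>\<omega>. g (T \<omega>) * level k \<omega> \<partial>M)"
    using integrable_mult_indicator[OF level_sets int]
    by (intro F.real_cond_exp_intg measurable_compose_rv_sigma[OF T g]) (simp_all add: mult.commute)
  finally show ?thesis .
qed

lemma integral_post: "(\<integral>\<omega>. post T k \<omega> \<partial>M) = p k"
  using integral_mult_post[of "\<lambda>_. 1", OF borel_measurable_const integrable_const]
  unfolding mult_1_left integral_level .

text \<open>Uniqueness of conditional expectations, restated on the value space of T: the sets of
  the sigma-algebra of T are the preimages of Borel sets.\<close>

lemma post_charact:
  assumes q: "q \<in> borel_measurable borel" "integrable M (\<lambda>\<omega>. q (T \<omega>))"
    and eq: "\<And>B. B \<in> sets borel \<Longrightarrow>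
      (LINT \<omega>:{\<omega> \<in> space M. T \<omega> \<in> B}|M. level k \<omega>) = (LINT \<omega>:{\<omega> \<in> space M. T \<omega> \<in> B}|M. q (T \<omega>))"
  shows "AE \<omega> in M. post T k \<omega> = q (T \<omega>)"
proof -
  have "AE \<omega> in M. real_cond_exp M (rv_sigma M borel T) (level k) \<omega> = q (T \<omega>)"
  proof (rule F.real_cond_exp_charact)
    fix A assume "A \<in> sets (rv_sigma M borel T)"
    then obtain B where "B \<in> sets borel" "A = {\<omega> \<in> space M. T \<omega> \<in> B}"
      unfolding sets_rv_sigma[OF T] by auto
    then show "(LINT \<omega>:A|M. level k \<omega>) = (LINT \<omega>:A|M. q (T \<omega>))" using eq by simp
  qed (use q measurable_compose_rv_sigma[OF T] in auto)
  then show ?thesis using post_eq[of k] by eventually_elim simp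
qed

lemma integrable_post: "integrable M (post T k)"
proof (rule integrable_const_bound)
  show "AE \<omega> in M. norm (post T k \<omega>) \<le> 1"
    using post_nonneg[of k] post_le_1[of k] by eventually_elim simp
qed (rule borel_measurable_post)

lemma integrable_post_mult: "integrable M (\<lambda>\<omega>. post T i \<omega> * post T j \<omega>)"
proof -
  have "AE \<omega> in M. norm (post T i \<omega> * post T j \<omega>) \<le> 1"
    using post_nonneg[of i] post_nonneg[of j] post_le_1[of i] post_le_1[of j]
    by eventually_elim (simp add: mult_le_one)
  then show ?thesis
    by (intro integrable_const_bound) auto
qed

text \<open>Given \<omega>, the two draws are independent with the same law, so the section of the
  event is a product set of measure Q_i(T) Q_j(T); Tonelli's theorem then integrates over
  \<omega>.\<close>

lemma joint_level_prob_eq: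
  assumes i: "i \<in> {1..K}" and j: "j \<in> {1..K}"
  shows "joint_level_prob M K T Y i j = (\<integral>\<omega>. post T i \<omega> * post T j \<omega> \<partial>M)"
proof -
  interpret U: prob_space unit_uniform by (rule prob_space_unit_uniform)
  interpret UU: pair_prob_space unit_uniform unit_uniform ..
  have [measurable_cong]: "sets unit_uniform = sets borel"
    unfolding unit_uniform_def by simp
  have sp: "space unit_uniform = UNIV"
    unfolding unit_uniform_def by simp
  let ?d = "\<lambda>\<omega> u. draw_level K (level_prob M T Y) (T \<omega>) u"
  let ?A = "{(\<omega>, u, u') \<in> space (extended_space M). ?d \<omega> u = i \<and> ?d \<omega> u' = j}"
  have A: "?A \<in> sets (extended_space M)"
  proof -
    have [measurable]: "(\<lambda>x. ?d (fst x) (fst (snd x))) \<in> extended_space M \<rightarrow>\<^sub>M count_space UNIV"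
      "(\<lambda>x. ?d (fst x) (snd (snd x))) \<in> extended_space M \<rightarrow>\<^sub>M count_space UNIV"
      unfolding extended_space_def draw_level_def by measurable
    have "?A = {x \<in> space (extended_space M).
        ?d (fst x) (fst (snd x)) = i \<and> ?d (fst x) (snd (snd x)) = j}"
      by auto
    also have "\<dots> \<in> sets (extended_space M)" by measurable
    finally show ?thesis .
  qed
  have dm [measurable]: "{u. ?d \<omega> u = k} \<in> sets unit_uniform" for \<omega> k
  proof -
    have [measurable]: "(\<lambda>u. ?d \<omega> u) \<in> borel \<rightarrow>\<^sub>M count_space UNIV"
      unfolding draw_level_def by measurable
    have "{u \<in> space borel. ?d \<omega> u = k} \<in> sets borel" by measurable
    then show ?thesis unfolding unit_uniform_def by simp
  qed
  have "emeasure (extended_space M) ?A =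
      (\<integral>\<^sup>+\<omega>. emeasure (unit_uniform \<Otimes>\<^sub>M unit_uniform) (Pair \<omega> -` ?A) \<partial>M)"
    using A unfolding extended_space_def by (rule UU.emeasure_pair_measure_alt)
  also have "\<dots> = (\<integral>\<^sup>+\<omega>. ennreal (post T i \<omega> * post T j \<omega>) \<partial>M)"
  proof (rule nn_integral_cong_AE)
    \<comment> \<open>\<open>level_prob\<close> is an arbitrary version, so it is a probability
      vector at T only outside a null set; only there does the draw have the stated law.\<close>
    have "AE \<omega> in M. \<forall>k\<in>{1..K}. 0 \<le> post T k \<omega>"
      using post_nonneg by (intro AE_ball_countable') auto
    then show "AE \<omega> in M. emeasure (unit_uniform \<Otimes>\<^sub>M unit_uniform) (Pair \<omega> -` ?A) =
        ennreal (post T i \<omega> * post T j \<omega>)"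
      using sum_post AE_space
    proof eventually_elim
      case (elim \<omega>)
      have "Pair \<omega> -` ?A = {u. ?d \<omega> u = i} \<times> {u. ?d \<omega> u = j}"
        using elim sp by (auto simp: extended_space_def space_pair_measure)
      then have "emeasure (unit_uniform \<Otimes>\<^sub>M unit_uniform) (Pair \<omega> -` ?A) =
          emeasure unit_uniform {u. ?d \<omega> u = i} * emeasure unit_uniform {u. ?d \<omega> u = j}"
        using dm by (simp add: U.emeasure_pair_measure_Times)
      also have "\<dots> = ennreal (post T i \<omega>) * ennreal (post T j \<omega>)"
        using elim i j
        by (intro arg_cong2[where f="(*)"] emeasure_draw_level[where t="T \<omega>" and Q="level_prob M T Y"]) auto
      finally show ?case using elim i j by (simp add: ennreal_mult)
    qed
  qed
  also have "\<dots> = ennreal (\<integral>\<omega>. post T i \<omega> * post T j \<omega> \<partial>M)"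
  proof (rule nn_integral_eq_integral)
    show "AE \<omega> in M. 0 \<le> post T i \<omega> * post T j \<omega>"
      using post_nonneg[of i] post_nonneg[of j] by eventually_elim simp
  qed (rule integrable_post_mult)
  finally have "emeasure (extended_space M) ?A = ennreal (\<integral>\<omega>. post T i \<omega> * post T j \<omega> \<partial>M)" .
  moreover have "0 \<le> (\<integral>\<omega>. post T i \<omega> * post T j \<omega> \<partial>M)"
  proof (rule integral_nonneg_AE)
    show "AE \<omega> in M. 0 \<le> post T i \<omega> * post T j \<omega>"
      using post_nonneg[of i] post_nonneg[of j] by eventually_elim simp
  qed
  ultimately show ?thesis
    unfolding joint_level_prob_def measure_def by simp
qed

lemma AE_abs_post_minus_p: "AE \<omega> in M. \<bar>post T k \<omega> - p k\<bar> \<le> 1"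
proof -
  have "0 \<le> p k" "p k \<le> 1" by (simp_all add: marginal_level_prob_def)
  then have *: "\<bar>x - p k\<bar> \<le> 1" if "0 \<le> x" "x \<le> 1" for x
    using that by linarith
  show ?thesis
    using post_nonneg[of k] post_le_1[of k] by eventually_elim (rule *)
qed

text \<open>As E[Q_i(T)] = p_i, the numerator p_ij - p_i p_j is the covariance of Q_i(T) and Q_j(T).
  From here on \<open>psi\<close> is handled only through energies.\<close>

lemma psi_eq_gram_energy:
  "psi M K T Y = gram_energy M {1..K} p (\<lambda>k \<omega>. post T k \<omega> - p k) / (real K - 1)"
proof -
  have "(\<integral>\<omega>. (post T i \<omega> - p i) * (post T j \<omega> - p j) \<partial>M) =
      joint_level_prob M K T Y i j - p i * p j" if "i \<in> {1..K}" "j \<in> {1..K}" for i j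
  proof -
    have "(\<integral>\<omega>. (post T i \<omega> - p i) * (post T j \<omega> - p j) \<partial>M) =
        (\<integral>\<omega>. (post T i \<omega> * post T j \<omega> - p j * post T i \<omega>) - (p i * post T j \<omega> - p i * p j) \<partial>M)"
      by (intro Bochner_Integration.integral_cong) (auto simp: algebra_simps)
    also have "\<dots> = (\<integral>\<omega>. post T i \<omega> * post T j \<omega> \<partial>M) - p j * p i - (p i * p j - p i * p j)"
      using integrable_post integrable_post_mult by (simp add: integral_post prob_space)
    finally show ?thesis
      using joint_level_prob_eq that by simp
  qed
  then show ?thesis
    unfolding psi_def gram_energy_def by simp
qed

end

text \<open>The energy at the end of the martingale, where Y is known. It explains the normalization
  of \<open>psi\<close>: complete information gives the value 1.\<close>

lemma gram_energy_level: "gram_energy M {1..K} p (\<lambda>k \<omega>. level k \<omega> - p k) = real K - 1"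
proof -
  have cov: "(\<integral>\<omega>. (level i \<omega> - p i) * (level j \<omega> - p j) \<partial>M) = (if i = j then p i else 0) - p i * p j"
    for i j
  proof -
    have *: "integrable M (\<lambda>\<omega>. level i \<omega> * level j \<omega>)"
      by (intro integrable_const_bound[of _ 1]) (auto simp: indicator_def)
    have "(\<integral>\<omega>. (level i \<omega> - p i) * (level j \<omega> - p j) \<partial>M) =
        (\<integral>\<omega>. (level i \<omega> * level j \<omega> - p j * level i \<omega>) - (p i * level j \<omega> - p i * p j) \<partial>M)"
      by (intro Bochner_Integration.integral_cong) (auto simp: algebra_simps)
    also have "\<dots> = (if i = j then p i else 0) - p j * p i - (p i * p j - p i * p j)"
      using * integrable_level
      by (simp add: integral_level_mult prob_space marginal_level_prob_def)
    finally show ?thesis by simp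
  qed
  \<comment> \<open>Off the diagonal the quotient is p_i p_j; on it, (1 - p_i)^2 = 1 - 2 p_i + p_i
    p_i. Since the p_i sum to 1, the total is (K - 2) + 1.\<close>
  have "((if i = j then p i else 0) - p i * p j)\<^sup>2 / (p i * p j) =
      (if i = j then 1 - 2 * p i else 0) + p i * p j" if "i \<in> {1..K}" "j \<in> {1..K}" for i j
    using pos[OF that(1)] pos[OF that(2)] by (auto simp: field_simps power2_eq_square)
  then have "gram_energy M {1..K} p (\<lambda>k \<omega>. level k \<omega> - p k) =
      (\<Sum>i=1..K. \<Sum>j=1..K. (if i = j then 1 - 2 * p i else 0) + p i * p j)"
    unfolding gram_energy_def cov by simp
  also have "\<dots> = (\<Sum>i=1..K. 1 - 2 * p i) + (\<Sum>i=1..K. p i) * (\<Sum>j=1..K. p j)"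
    by (simp add: sum.distrib sum_product)
  also have "\<dots> = real K - 1"
    by (simp add: sum_subtractf sum_distrib_left[symmetric] sum_p del: One_nat_def)
  finally show ?thesis .
qed

subsection \<open>Monotonicity of psi and the extreme cases\<close>

lemma level_event_relabel:
  assumes l: "bij_betw l {1..K} {1..K}" and k: "k \<in> {1..K}"
  shows "{\<omega> \<in> space M. (l \<circ> Y) \<omega> = l k} = {\<omega> \<in> space M. Y \<omega> = k}"
proof (rule Collect_cong)
  fix \<omega>
  show "\<omega> \<in> space M \<and> (l \<circ> Y) \<omega> = l k \<longleftrightarrow> \<omega> \<in> space M \<and> Y \<omega> = k"
    using measurable_space[OF Y, of \<omega>] k bij_betw_imp_inj_on[OF l]
    by (simp add: inj_on_eq_iff cong: conj_cong)
qed

context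
  fixes T :: "'a \<Rightarrow> 'h::topological_space"
  assumes T [measurable]: "T \<in> M \<rightarrow>\<^sub>M borel"
begin

text \<open>Equivalently, the residual \<open>level j\<close> - \<open>post T j\<close> is
  orthogonal to the centred \<open>post T i\<close>.\<close>

lemma integral_centred_mult_post:
  "(\<integral>\<omega>. (post T i \<omega> - p i) * post T j \<omega> \<partial>M) = (\<integral>\<omega>. (post T i \<omega> - p i) * level j \<omega> \<partial>M)"
  using integral_mult_post[OF T, of "\<lambda>t. level_prob M T Y i t - p i" j]
    level_prob_borel[of T i] integrable_post[OF T, of i] by simp

lemma AE_abs_post: "AE \<omega> in M. \<bar>post T k \<omega>\<bar> \<le> 1"
  using post_nonneg[OF T, of k] post_le_1[OF T, of k] by eventually_elim auto

lemma AE_abs_level: "AE \<omega> in M. \<bar>level k \<omega>\<bar> \<le> 1"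
  by (auto simp: indicator_def)

lemma AE_abs_level_minus_post: "AE \<omega> in M. \<bar>level k \<omega> - post T k \<omega>\<bar> \<le> 1"
  using post_nonneg[OF T, of k] post_le_1[OF T, of k]
  by eventually_elim (auto simp: indicator_def)

text \<open>Superadditivity for the orthogonal splitting level - p = (post - p) + (level - post),
  whose left side has energy K - 1. One bound gives both \<open>psi_le_1\<close> and its equality
  case.\<close>

lemma gram_energy_level_minus_post:
  "gram_energy M {1..K} p (\<lambda>k \<omega>. level k \<omega> - post T k \<omega>) \<le> (real K - 1) * (1 - psi M K T Y)"
proof -
  let ?a = "\<lambda>k \<omega>. post T k \<omega> - p k" and ?r = "\<lambda>k \<omega>. level k \<omega> - post T k \<omega>"
  note bounds = AE_abs_post_minus_p[OF T] AE_abs_level_minus_post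
  have "gram_energy M {1..K} p ?a + gram_energy M {1..K} p ?r \<le>
      gram_energy M {1..K} p (\<lambda>k \<omega>. ?a k \<omega> + ?r k \<omega>)"
  proof (rule gram_energy_orthogonal_sum)
    fix i j
    have "(\<integral>\<omega>. ?a i \<omega> * ?r j \<omega> \<partial>M) = (\<integral>\<omega>. ?a i \<omega> * level j \<omega> \<partial>M) - (\<integral>\<omega>. ?a i \<omega> * post T j \<omega> \<partial>M)"
    proof (subst Bochner_Integration.integral_diff[symmetric])
      show "integrable M (\<lambda>\<omega>. ?a i \<omega> * level j \<omega>)" "integrable M (\<lambda>\<omega>. ?a i \<omega> * post T j \<omega>)"
        by (intro integrable_bounded_mult bounds AE_abs_post AE_abs_level; measurable)+
    qed (simp add: right_diff_distrib)
    then show "(\<integral>\<omega>. ?a i \<omega> * ?r j \<omega> \<partial>M) = 0"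
      using integral_centred_mult_post by simp
  qed (intro integrable_bounded_mult bounds; measurable)+
  then show ?thesis
    using K gram_energy_level by (simp add: psi_eq_gram_energy[OF T] right_diff_distrib)
qed

lemma psi_le_1: "psi M K T Y \<le> 1"
proof -
  have "0 \<le> (real K - 1) * (1 - psi M K T Y)"
    using gram_energy_nonneg[of "{1..K}" p M] pos gram_energy_level_minus_post order_trans by blast
  then show ?thesis using K by (simp add: zero_le_mult_iff)
qed

lemma psi_eq_1_iff: "psi M K T Y = 1 \<longleftrightarrow> (\<forall>k\<in>{1..K}. AE \<omega> in M. post T k \<omega> = level k \<omega>)"
proof
  assume "psi M K T Y = 1"
  then have "gram_energy M {1..K} p (\<lambda>k \<omega>. level k \<omega> - post T k \<omega>) \<le> 0"
    using gram_energy_level_minus_post by simp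
  then have *: "AE \<omega> in M. level k \<omega> - post T k \<omega> = 0" if "k \<in> {1..K}" for k
    using pos AE_abs_level_minus_post that
    by (intro gram_energy_le_0_imp_AE_0[of "{1..K}" p M "\<lambda>k \<omega>. level k \<omega> - post T k \<omega>"])
      (auto intro!: integrable_bounded_mult)
  show "\<forall>k\<in>{1..K}. AE \<omega> in M. post T k \<omega> = level k \<omega>"
  proof
    fix k assume "k \<in> {1..K}"
    from *[OF this] show "AE \<omega> in M. post T k \<omega> = level k \<omega>" by eventually_elim simp
  qed
next
  assume "\<forall>k\<in>{1..K}. AE \<omega> in M. post T k \<omega> = level k \<omega>"
  then have "gram_energy M {1..K} p (\<lambda>k \<omega>. post T k \<omega> - p k) =
      gram_energy M {1..K} p (\<lambda>k \<omega>. level k \<omega> - p k)"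
    by (intro gram_energy_cong_AE) auto
  then show "psi M K T Y = 1"
    using K gram_energy_level by (simp add: psi_eq_gram_energy[OF T])
qed

lemma psi_eq_1_iff_measurable_function:
  "psi M K T Y = 1 \<longleftrightarrow> (\<exists>h \<in> borel \<rightarrow>\<^sub>M count_space {1..K}. AE \<omega> in M. Y \<omega> = h (T \<omega>))"
  unfolding psi_eq_1_iff
proof
  assume ae: "\<forall>k\<in>{1..K}. AE \<omega> in M. post T k \<omega> = level k \<omega>"
  \<comment> \<open>h picks the level of conditional probability 1. The alternative k = K is a
    default that keeps the minimum well defined, with value in {1..K}, at every t; it cannot
    undercut the true level, as no level exceeds K.\<close>
  let ?P = "\<lambda>t k. k \<in> {1..K} \<and> (level_prob M T Y k t = 1 \<or> k = K)"
  define h where "h t = (LEAST k. ?P t k)" for t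
  have h: "h \<in> borel \<rightarrow>\<^sub>M count_space {1..K}"
  proof -
    note [measurable] = level_prob_borel
    have m: "h \<in> borel \<rightarrow>\<^sub>M count_space UNIV"
      unfolding h_def by measurable
    have r: "h t \<in> {1..K}" for t
      unfolding h_def using LeastI[of "?P t" K] K by auto
    show ?thesis
      using measurable_sets[OF m] r by (intro measurableI) auto
  qed
  have "AE \<omega> in M. \<forall>k\<in>{1..K}. post T k \<omega> = level k \<omega>"
    using ae by (intro AE_ball_countable') auto
  then have "AE \<omega> in M. Y \<omega> = h (T \<omega>)"
    using AE_space
  proof eventually_elim
    case (elim \<omega>)
    have Y_in: "Y \<omega> \<in> {1..K}" using measurable_space[OF Y] elim by auto
    show ?case
      unfolding h_def
    proof (rule Least_equality[symmetric])
      show "?P (T \<omega>) (Y \<omega>)" using elim Y_in by auto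
      fix k assume "?P (T \<omega>) k"
      then show "Y \<omega> \<le> k" using elim Y_in by (auto simp: indicator_def split: if_splits)
    qed
  qed
  with h show "\<exists>h \<in> borel \<rightarrow>\<^sub>M count_space {1..K}. AE \<omega> in M. Y \<omega> = h (T \<omega>)" by blast
next
  assume "\<exists>h \<in> borel \<rightarrow>\<^sub>M count_space {1..K}. AE \<omega> in M. Y \<omega> = h (T \<omega>)"
  then obtain h where h: "h \<in> borel \<rightarrow>\<^sub>M count_space {1..K}" and ae: "AE \<omega> in M. Y \<omega> = h (T \<omega>)"
    by blast
  show "\<forall>k\<in>{1..K}. AE \<omega> in M. post T k \<omega> = level k \<omega>"
  proof
    fix k assume k: "k \<in> {1..K}"
    \<comment> \<open>The indicator of Y = k agrees almost surely with a Borel function of T, and is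
      therefore its own conditional probability given T.\<close>
    have "h -` {k} \<in> sets borel"
      using measurable_sets[OF h, of "{k}"] k by simp
    then have q: "indicat_real (h -` {k}) \<in> borel_measurable borel" by simp
    note [measurable] = measurable_compose[OF T q]
    have lev: "AE \<omega> in M. level k \<omega> = indicat_real (h -` {k}) (T \<omega>)"
      using ae AE_space by eventually_elim (auto simp: indicator_def)
    have "AE \<omega> in M. post T k \<omega> = indicat_real (h -` {k}) (T \<omega>)"
    proof (rule post_charact[OF T])
      show "integrable M (\<lambda>\<omega>. indicat_real (h -` {k}) (T \<omega>))"
        by (rule integrable_const_bound[of _ 1, OF _ measurable_compose[OF T q]]) (simp add: indicator_def)
      fix B :: "'h set" assume [measurable]: "B \<in> sets borel"
      show "(LINT \<omega>:{\<omega> \<in> space M. T \<omega> \<in> B}|M. level k \<omega>) =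
          (LINT \<omega>:{\<omega> \<in> space M. T \<omega> \<in> B}|M. indicat_real (h -` {k}) (T \<omega>))"
      proof (rule set_lebesgue_integral_cong_AE)
        show "AE \<omega>\<in>{\<omega> \<in> space M. T \<omega> \<in> B} in M. level k \<omega> = indicat_real (h -` {k}) (T \<omega>)"
          using lev by eventually_elim blast
      qed measurable
    qed (rule q)
    with lev show "AE \<omega> in M. post T k \<omega> = level k \<omega>" by eventually_elim simp
  qed
qed

section \<open>Refining the conditioning variable from T to S, where T is a function of S\<close>

context
  fixes S :: "'a \<Rightarrow> 'k::topological_space" and \<phi> :: "'k \<Rightarrow> 'h"
  assumes S [measurable]: "S \<in> M \<rightarrow>\<^sub>M borel" and \<phi> [measurable]: "\<phi> \<in> borel \<rightarrow>\<^sub>M borel"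
    and factor: "\<And>\<omega>. \<omega> \<in> space M \<Longrightarrow> T \<omega> = \<phi> (S \<omega>)"
begin

lemma AE_abs_post_S: "AE \<omega> in M. \<bar>post S k \<omega>\<bar> \<le> 1"
  using post_nonneg[OF S, of k] post_le_1[OF S, of k] by eventually_elim auto

lemma AE_abs_post_diff: "AE \<omega> in M. \<bar>post S k \<omega> - post T k \<omega>\<bar> \<le> 1"
  using post_nonneg[OF T, of k] post_le_1[OF T, of k] post_nonneg[OF S, of k] post_le_1[OF S, of k]
  by eventually_elim auto

text \<open>The same superadditivity one step earlier in the martingale: Q_S - p splits into Q_T - p
  and the increment Q_S - Q_T.\<close>

lemma gram_energy_post_diff:
  "gram_energy M {1..K} p (\<lambda>k \<omega>. post S k \<omega> - post T k \<omega>) \<le>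
    (real K - 1) * (psi M K S Y - psi M K T Y)"
proof -
  note [measurable] = borel_measurable_post[OF S] borel_measurable_post[OF T]
  let ?a = "\<lambda>k \<omega>. post T k \<omega> - p k" and ?r = "\<lambda>k \<omega>. post S k \<omega> - post T k \<omega>"
  note bounds = AE_abs_post_minus_p[OF T] AE_abs_post_diff
  have "gram_energy M {1..K} p ?a + gram_energy M {1..K} p ?r \<le>
      gram_energy M {1..K} p (\<lambda>k \<omega>. ?a k \<omega> + ?r k \<omega>)"
  proof (rule gram_energy_orthogonal_sum)
    fix i j
    let ?g = "\<lambda>s. level_prob M T Y i (\<phi> s) - p i"
    have g: "?g \<in> borel_measurable borel"
      using measurable_compose[OF \<phi> level_prob_borel] by simp
    have "integrable M (\<lambda>\<omega>. ?g (S \<omega>)) \<longleftrightarrow> integrable M (?a i)"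
      by (intro Bochner_Integration.integrable_cong) (simp_all add: factor)
    then have int: "integrable M (\<lambda>\<omega>. ?g (S \<omega>))"
      using integrable_post[OF T, of i] by simp
    \<comment> \<open>Tower property in integrated form: \<open>?a i\<close> is a function of T and,
      through \<open>\<phi>\<close>, of S, so both posteriors can be traded for
      \<open>level j\<close>.\<close>
    have "(\<integral>\<omega>. ?a i \<omega> * post S j \<omega> \<partial>M) = (\<integral>\<omega>. ?g (S \<omega>) * post S j \<omega> \<partial>M)"
      by (intro Bochner_Integration.integral_cong) (simp_all add: factor)
    also have "\<dots> = (\<integral>\<omega>. ?g (S \<omega>) * level j \<omega> \<partial>M)"
      by (rule integral_mult_post[OF S g int])
    also have "\<dots> = (\<integral>\<omega>. ?a i \<omega> * level j \<omega> \<partial>M)"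
      by (intro Bochner_Integration.integral_cong) (simp_all add: factor)
    also have "\<dots> = (\<integral>\<omega>. ?a i \<omega> * post T j \<omega> \<partial>M)"
      by (rule integral_centred_mult_post[symmetric])
    finally have eq: "(\<integral>\<omega>. ?a i \<omega> * post S j \<omega> \<partial>M) = (\<integral>\<omega>. ?a i \<omega> * post T j \<omega> \<partial>M)" .
    have "(\<integral>\<omega>. ?a i \<omega> * ?r j \<omega> \<partial>M) = (\<integral>\<omega>. ?a i \<omega> * post S j \<omega> \<partial>M) - (\<integral>\<omega>. ?a i \<omega> * post T j \<omega> \<partial>M)"
    proof (subst Bochner_Integration.integral_diff[symmetric])
      show "integrable M (\<lambda>\<omega>. ?a i \<omega> * post S j \<omega>)" "integrable M (\<lambda>\<omega>. ?a i \<omega> * post T j \<omega>)"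
        by (intro integrable_bounded_mult bounds AE_abs_post AE_abs_post_S; measurable)+
    qed (simp add: right_diff_distrib)
    then show "(\<integral>\<omega>. ?a i \<omega> * ?r j \<omega> \<partial>M) = 0"
      using eq by simp
  qed (intro integrable_bounded_mult bounds; measurable)+
  then show ?thesis
    using K by (simp add: psi_eq_gram_energy[OF T] psi_eq_gram_energy[OF S] right_diff_distrib)
qed

lemma psi_mono: "psi M K T Y \<le> psi M K S Y"
proof -
  have "0 \<le> (real K - 1) * (psi M K S Y - psi M K T Y)"
    using gram_energy_nonneg[of "{1..K}" p M] pos gram_energy_post_diff order_trans by blast
  then show ?thesis using K by (simp add: zero_le_mult_iff)
qed

lemma psi_eq_iff:
  "psi M K S Y = psi M K T Y \<longleftrightarrow> (\<forall>k\<in>{1..K}. AE \<omega> in M. post S k \<omega> = post T k \<omega>)"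
proof
  note [measurable] = borel_measurable_post[OF S] borel_measurable_post[OF T]
  {
    assume "psi M K S Y = psi M K T Y"
    then have "gram_energy M {1..K} p (\<lambda>k \<omega>. post S k \<omega> - post T k \<omega>) \<le> 0"
      using gram_energy_post_diff by simp
    then have "AE \<omega> in M. post S k \<omega> - post T k \<omega> = 0" if "k \<in> {1..K}" for k
      using pos AE_abs_post_diff that
      by (intro gram_energy_le_0_imp_AE_0[of "{1..K}" p M "\<lambda>k \<omega>. post S k \<omega> - post T k \<omega>"])
        (auto intro!: integrable_bounded_mult)
    then show "\<forall>k\<in>{1..K}. AE \<omega> in M. post S k \<omega> = post T k \<omega>"
      by simp
  next
    assume "\<forall>k\<in>{1..K}. AE \<omega> in M. post S k \<omega> = post T k \<omega>"
    then have "gram_energy M {1..K} p (\<lambda>k \<omega>. post S k \<omega> - p k) =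
        gram_energy M {1..K} p (\<lambda>k \<omega>. post T k \<omega> - p k)"
      by (intro gram_energy_cong_AE) auto
    then show "psi M K S Y = psi M K T Y"
      by (simp add: psi_eq_gram_energy[OF T] psi_eq_gram_energy[OF S])
  }
qed

end

end

section \<open>Invariance under relabelling of the levels\<close>

lemma categorical_rv_relabel:
  assumes l: "bij_betw l {1..K} {1..K}"
  shows "categorical_rv M K (l \<circ> Y)"
proof (intro categorical_rv.intro categorical_rv_axioms.intro)
  show "l \<circ> Y \<in> M \<rightarrow>\<^sub>M count_space {1..K}"
    using l by (intro measurable_comp[OF Y]) (auto simp: bij_betw_def)
  fix k assume "k \<in> {1..K}"
  then obtain j where j: "j \<in> {1..K}" "k = l j"
    using bij_betw_imp_surj_on[OF l] by blast
  show "0 < marginal_level_prob M (l \<circ> Y) k"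
    unfolding j(2) marginal_level_prob_def level_event_relabel[OF l j(1)]
    using pos[OF j(1)] unfolding marginal_level_prob_def .
qed (rule prob_space_axioms K)+

lemma psi_relabel:
  fixes T :: "'a \<Rightarrow> 'h::topological_space"
  assumes l: "bij_betw l {1..K} {1..K}" and T: "T \<in> M \<rightarrow>\<^sub>M borel"
  shows "psi M K T (l \<circ> Y) = psi M K T Y"
proof -
  let ?p = "marginal_level_prob M (l \<circ> Y)" and ?q = "level_prob M T (l \<circ> Y)"
  have "gram_energy M {1..K} ?p (\<lambda>k \<omega>. ?q k (T \<omega>) - ?p k) =
      gram_energy M {1..K} p (\<lambda>k \<omega>. post T k \<omega> - p k)"
  proof (rule trans[OF gram_energy_reindex[OF l] gram_energy_cong])
    fix k assume k: "k \<in> {1..K}"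
    have marg: "?p (l k) = p k"
      unfolding marginal_level_prob_def level_event_relabel[OF l k] ..
    \<comment> \<open>The choice in \<open>level_prob\<close> depends on Y only through the event of
      the level. The two events coincide, so the chosen functions are equal, not just almost surely
      equal.\<close>
    have "?q (l k) = level_prob M T Y k"
      unfolding level_prob_def level_event_relabel[OF l k] ..
    with marg show "((\<lambda>k \<omega>. ?q k (T \<omega>) - ?p k) \<circ> l) k = (\<lambda>\<omega>. post T k \<omega> - p k)"
      by (simp only: comp_apply[where g = l])
    show "(?p \<circ> l) k = p k"
      using marg by (simp only: comp_apply[where g = l])
  qed
  then show ?thesis
    unfolding psi_eq_gram_energy[OF T]
      categorical_rv.psi_eq_gram_energy[OF categorical_rv_relabel[OF l] T] by (rule arg_cong)
qed

subsection \<open>Conditional independence\<close>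

context
  fixes X :: "'a \<Rightarrow> 'h::{metric_space, second_countable_topology}"
    and Z :: "'a \<Rightarrow> 'z::{metric_space, second_countable_topology}"
  assumes X [measurable]: "X \<in> M \<rightarrow>\<^sub>M borel" and Z [measurable]: "Z \<in> M \<rightarrow>\<^sub>M borel"
begin

interpretation F: sigma_finite_subalgebra M "rv_sigma M borel X"
  by (rule sigma_finite_subalgebra_rv_sigma[OF X])

text \<open>Separability enters here: it makes the Borel sigma-algebra of the product space the
  product of the Borel sigma-algebras.\<close>

lemma measurable_pair_borel [measurable]: "(\<lambda>\<omega>. (X \<omega>, Z \<omega>)) \<in> M \<rightarrow>\<^sub>M borel"
  unfolding borel_prod[symmetric] by measurable

lemma fst_borel: "(fst :: 'h \<times> 'z \<Rightarrow> 'h) \<in> borel \<rightarrow>\<^sub>M borel"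
  unfolding borel_prod[symmetric] by (rule measurable_fst)

text \<open>The factor 1_B(X) Q_k(X) is measurable for the sigma-algebra of X, so P(Z in A | X) may
  be replaced by the indicator of Z in A.\<close>

lemma integral_post_X_mult:
  assumes A [measurable]: "A \<in> sets borel" and B [measurable]: "B \<in> sets borel"
  shows "(\<integral>\<omega>. indicator B (X \<omega>) * (post X k \<omega> * real_cond_exp M (rv_sigma M borel X)
      (indicator {\<omega> \<in> space M. Z \<omega> \<in> A}) \<omega>) \<partial>M) =
    (\<integral>\<omega>. indicator B (X \<omega>) * indicator A (Z \<omega>) * post X k \<omega> \<partial>M)"
proof -
  let ?Z = "indicat_real {\<omega> \<in> space M. Z \<omega> \<in> A}"
  let ?g = "\<lambda>\<omega>. indicat_real B (X \<omega>) * post X k \<omega>"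
  note [measurable] = borel_measurable_post[OF X] level_prob_borel[OF X]
  have int: "integrable M (\<lambda>\<omega>. ?g \<omega> * ?Z \<omega>)"
  proof (rule integrable_bounded_mult)
    show "AE \<omega> in M. \<bar>?g \<omega>\<bar> \<le> 1"
      using AE_abs_post[OF X, of k] by eventually_elim (simp add: indicator_def)
    show "AE \<omega> in M. \<bar>?Z \<omega>\<bar> \<le> 1" by (simp add: indicator_def)
  qed measurable
  have "(\<integral>\<omega>. ?g \<omega> * real_cond_exp M (rv_sigma M borel X) ?Z \<omega> \<partial>M) = (\<integral>\<omega>. ?g \<omega> * ?Z \<omega> \<partial>M)"
    using int by (intro F.real_cond_exp_intg
        measurable_compose_rv_sigma[OF X, of "\<lambda>x. indicator B x * level_prob M X Y k x"]) measurable
  also have "\<dots> = (\<integral>\<omega>. indicator B (X \<omega>) * indicator A (Z \<omega>) * post X k \<omega> \<partial>M)"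
    by (intro Bochner_Integration.integral_cong) (auto simp: indicator_def)
  finally show ?thesis
    by (simp add: mult.assoc)
qed

text \<open>A conditional expectation given X is determined by its integrals over the events X in B.
  Those of the two sides are the two integrals on the right, which form the common criterion linking
  conditional independence to \<open>post\<close>.\<close>

lemma cond_exp_level_factorizes_iff_rectangles:
  "(AE \<omega> in M. real_cond_exp M (rv_sigma M borel X) (indicator {\<omega> \<in> space M. Z \<omega> \<in> A \<and> Y \<omega> = k}) \<omega> =
      real_cond_exp M (rv_sigma M borel X) (indicator {\<omega> \<in> space M. Z \<omega> \<in> A}) \<omega> *
      real_cond_exp M (rv_sigma M borel X) (level k) \<omega>) \<longleftrightarrow>
   (\<forall>B\<in>sets borel. (\<integral>\<omega>. indicator B (X \<omega>) * indicator A (Z \<omega>) * level k \<omega> \<partial>M) =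
      (\<integral>\<omega>. indicator B (X \<omega>) * indicator A (Z \<omega>) * post X k \<omega> \<partial>M))"
  (is "(AE \<omega> in M. ?E ?ZY \<omega> = ?E ?Z \<omega> * ?E (level k) \<omega>) \<longleftrightarrow> _")
  if A [measurable]: "A \<in> sets borel"
proof -
  note [measurable] = borel_measurable_post[OF X] level_prob_borel[OF X]
  have ZY_sets [measurable]: "{\<omega> \<in> space M. Z \<omega> \<in> A \<and> Y \<omega> = k} \<in> sets M"
  proof -
    have "{\<omega> \<in> space M. Z \<omega> \<in> A \<and> Y \<omega> = k} = {\<omega> \<in> space M. Z \<omega> \<in> A} \<inter> {\<omega> \<in> space M. Y \<omega> = k}"
      by auto
    then show ?thesis by simp
  qed
  have int_ind: "integrable M (indicat_real C)" if "C \<in> sets M" for C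
    using that by (intro integrable_const_bound[of _ 1]) (auto simp: indicator_def)
  have prod: "AE \<omega> in M. ?E ?Z \<omega> * ?E (level k) \<omega> = post X k \<omega> * ?E ?Z \<omega>"
    using post_eq[OF X, of k] by eventually_elim simp
  have L: "(LINT \<omega>:{\<omega> \<in> space M. X \<omega> \<in> B}|M. ?ZY \<omega>) =
      (\<integral>\<omega>. indicator B (X \<omega>) * indicator A (Z \<omega>) * level k \<omega> \<partial>M)" for B
    unfolding set_lebesgue_integral_def
    by (intro Bochner_Integration.integral_cong) (auto simp: indicator_def)
  have R: "(LINT \<omega>:{\<omega> \<in> space M. X \<omega> \<in> B}|M. post X k \<omega> * ?E ?Z \<omega>) =
      (\<integral>\<omega>. indicator B (X \<omega>) * indicator A (Z \<omega>) * post X k \<omega> \<partial>M)" if "B \<in> sets borel" for B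
    unfolding set_lebesgue_integral_def integral_post_X_mult[OF A that, symmetric]
    by (intro Bochner_Integration.integral_cong) (auto simp: indicator_def)
  show ?thesis
  proof
    assume "AE \<omega> in M. ?E ?ZY \<omega> = ?E ?Z \<omega> * ?E (level k) \<omega>"
    with prod have eq: "AE \<omega> in M. ?E ?ZY \<omega> = post X k \<omega> * ?E ?Z \<omega>"
      by eventually_elim simp
    show "\<forall>B\<in>sets borel. (\<integral>\<omega>. indicator B (X \<omega>) * indicator A (Z \<omega>) * level k \<omega> \<partial>M) =
      (\<integral>\<omega>. indicator B (X \<omega>) * indicator A (Z \<omega>) * post X k \<omega> \<partial>M)"
    proof
      fix B :: "'h set" assume B [measurable]: "B \<in> sets borel"
      have "{\<omega> \<in> space M. X \<omega> \<in> B} \<in> sets (rv_sigma M borel X)"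
        unfolding sets_rv_sigma[OF X] using B by blast
      then have "(LINT \<omega>:{\<omega> \<in> space M. X \<omega> \<in> B}|M. ?ZY \<omega>) = (LINT \<omega>:{\<omega> \<in> space M. X \<omega> \<in> B}|M. ?E ?ZY \<omega>)"
        by (intro F.real_cond_exp_intA int_ind ZY_sets)
      also have "\<dots> = (LINT \<omega>:{\<omega> \<in> space M. X \<omega> \<in> B}|M. post X k \<omega> * ?E ?Z \<omega>)"
      proof (rule set_lebesgue_integral_cong_AE)
        show "AE \<omega>\<in>{\<omega> \<in> space M. X \<omega> \<in> B} in M. ?E ?ZY \<omega> = post X k \<omega> * ?E ?Z \<omega>"
          using eq by eventually_elim blast
      qed measurable
      finally show "(\<integral>\<omega>. indicator B (X \<omega>) * indicator A (Z \<omega>) * level k \<omega> \<partial>M) =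
          (\<integral>\<omega>. indicator B (X \<omega>) * indicator A (Z \<omega>) * post X k \<omega> \<partial>M)"
        unfolding L R[OF B] .
    qed
  next
    assume eq: "\<forall>B\<in>sets borel. (\<integral>\<omega>. indicator B (X \<omega>) * indicator A (Z \<omega>) * level k \<omega> \<partial>M) =
      (\<integral>\<omega>. indicator B (X \<omega>) * indicator A (Z \<omega>) * post X k \<omega> \<partial>M)"
    have "AE \<omega> in M. ?E ?ZY \<omega> = post X k \<omega> * ?E ?Z \<omega>"
    proof (rule F.real_cond_exp_charact)
      fix D assume "D \<in> sets (rv_sigma M borel X)"
      then obtain B where B: "B \<in> sets borel" "D = {\<omega> \<in> space M. X \<omega> \<in> B}"
        unfolding sets_rv_sigma[OF X] by auto
      then show "(LINT \<omega>:D|M. ?ZY \<omega>) = (LINT \<omega>:D|M. post X k \<omega> * ?E ?Z \<omega>)"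
        using eq unfolding B(2) L R[OF B(1)] by blast
    next
      show "(\<lambda>\<omega>. post X k \<omega> * ?E ?Z \<omega>) \<in> borel_measurable (rv_sigma M borel X)"
        by (intro borel_measurable_times measurable_compose_rv_sigma[OF X level_prob_borel[OF X]]
            borel_measurable_cond_exp)
      have "integrable M (\<lambda>\<omega>. post X k \<omega> * ?Z \<omega>)"
        by (intro integrable_bounded_mult AE_abs_post[OF X]) (simp_all add: indicator_def)
      then show "integrable M (\<lambda>\<omega>. post X k \<omega> * ?E ?Z \<omega>)"
        by (intro F.real_cond_exp_intg(1) measurable_compose_rv_sigma[OF X level_prob_borel[OF X]]) measurable
    qed (intro int_ind ZY_sets)
    with prod show "AE \<omega> in M. ?E ?ZY \<omega> = ?E ?Z \<omega> * ?E (level k) \<omega>"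
      by eventually_elim (simp only:)
  qed
qed

text \<open>The right side says that \<open>post X k\<close> has the integrals of
  \<open>level k\<close> over all events X in B, Z in A. Rectangles suffice to identify it as the
  conditional probability given the pair.\<close>

lemma post_pair_eq_iff_rectangles:
  "(AE \<omega> in M. post (\<lambda>\<omega>. (X \<omega>, Z \<omega>)) k \<omega> = post X k \<omega>) \<longleftrightarrow>
   (\<forall>A\<in>sets borel. \<forall>B\<in>sets borel.
      (\<integral>\<omega>. indicator B (X \<omega>) * indicator A (Z \<omega>) * level k \<omega> \<partial>M) =
      (\<integral>\<omega>. indicator B (X \<omega>) * indicator A (Z \<omega>) * post X k \<omega> \<partial>M))"
  (is "?L \<longleftrightarrow> ?R")
proof
  let ?S = "\<lambda>\<omega>. (X \<omega>, Z \<omega>)"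
  note [measurable] = borel_measurable_post[OF X] borel_measurable_post[OF measurable_pair_borel]
  {
    assume eq: ?L
    show ?R
    proof (intro ballI)
      fix A :: "'z set" and B :: "'h set" assume [measurable]: "A \<in> sets borel" "B \<in> sets borel"
      let ?g = "indicat_real (B \<times> A)"
      have g: "?g \<in> borel_measurable borel"
        unfolding borel_prod[symmetric] by measurable
      have int: "integrable M (\<lambda>\<omega>. ?g (?S \<omega>))"
        using measurable_compose[OF measurable_pair_borel g]
        by (intro integrable_const_bound[of _ 1]) (auto simp: indicator_def)
      have ind: "indicator B (X \<omega>) * indicator A (Z \<omega>) = ?g (?S \<omega>)" for \<omega>
        by (simp add: indicator_def)
      show "(\<integral>\<omega>. indicator B (X \<omega>) * indicator A (Z \<omega>) * level k \<omega> \<partial>M) =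
          (\<integral>\<omega>. indicator B (X \<omega>) * indicator A (Z \<omega>) * post X k \<omega> \<partial>M)"
        unfolding ind integral_mult_post[OF measurable_pair_borel g int, symmetric]
      proof (rule integral_cong_AE)
        show "AE \<omega> in M. ?g (?S \<omega>) * post ?S k \<omega> = ?g (?S \<omega>) * post X k \<omega>"
          using eq by eventually_elim simp
      qed (intro borel_measurable_times measurable_compose[OF measurable_pair_borel g]; measurable)+
    qed
  next
    assume rect: ?R
    let ?f = "\<lambda>\<omega>. level k \<omega> - post X k \<omega>"
    \<comment> \<open>From rectangles to all Borel sets of the product space, by the Dynkin system
      argument.\<close>
    have zero: "(LINT \<omega>:{\<omega> \<in> space M. ?S \<omega> \<in> C}|M. ?f \<omega>) = 0" if "C \<in> sets borel" for C
    proof (rule set_integral_pair_eq_0I[OF X Z])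
      show "integrable M ?f"
        using integrable_post[OF X] by simp
      show "C \<in> sets (borel \<Otimes>\<^sub>M borel)"
        using that unfolding borel_prod .
      fix B :: "'h set" and A :: "'z set" assume AB [measurable]: "B \<in> sets borel" "A \<in> sets borel"
      let ?g = "\<lambda>\<omega>. indicat_real B (X \<omega>) * indicat_real A (Z \<omega>)"
      have bound: "AE \<omega> in M. \<bar>?g \<omega>\<bar> \<le> 1"
        by (simp add: indicator_def)
      have "(LINT \<omega>:{\<omega> \<in> space M. X \<omega> \<in> B \<and> Z \<omega> \<in> A}|M. ?f \<omega>) =
          (\<integral>\<omega>. ?g \<omega> * level k \<omega> - ?g \<omega> * post X k \<omega> \<partial>M)"
        unfolding set_lebesgue_integral_def
        by (intro Bochner_Integration.integral_cong) (auto simp: indicator_def)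
      also have "\<dots> = (\<integral>\<omega>. ?g \<omega> * level k \<omega> \<partial>M) - (\<integral>\<omega>. ?g \<omega> * post X k \<omega> \<partial>M)"
        by (intro Bochner_Integration.integral_diff integrable_bounded_mult bound
            AE_abs_post[OF X] AE_abs_level; measurable)
      also have "\<dots> = 0" using rect AB by simp
      finally show "(LINT \<omega>:{\<omega> \<in> space M. X \<omega> \<in> B \<and> Z \<omega> \<in> A}|M. ?f \<omega>) = 0" .
    qed
    \<comment> \<open>\<open>post X k\<close> is read as a function of the pair through
      \<open>fst\<close>, so that \<open>post_charact\<close> applies to it.\<close>
    have "AE \<omega> in M. post ?S k \<omega> = (\<lambda>s. level_prob M X Y k (fst s)) (?S \<omega>)"
    proof (rule post_charact[OF measurable_pair_borel])
      show "(\<lambda>s. level_prob M X Y k (fst s)) \<in> borel_measurable (borel :: ('h \<times> 'z) measure)"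
        by (rule measurable_compose[OF fst_borel level_prob_borel[OF X]])
      show "integrable M (\<lambda>\<omega>. level_prob M X Y k (fst (?S \<omega>)))"
        using integrable_post[OF X] by simp
      fix C :: "('h \<times> 'z) set" assume C: "C \<in> sets borel"
      have D: "{\<omega> \<in> space M. ?S \<omega> \<in> C} \<in> sets M"
        using measurable_sets[OF measurable_pair_borel C] by (simp add: vimage_def Int_def conj_commute)
      have "(LINT \<omega>:{\<omega> \<in> space M. ?S \<omega> \<in> C}|M. ?f \<omega>) =
          (LINT \<omega>:{\<omega> \<in> space M. ?S \<omega> \<in> C}|M. level k \<omega>) - (LINT \<omega>:{\<omega> \<in> space M. ?S \<omega> \<in> C}|M. post X k \<omega>)"
        by (intro set_integral_diff; unfold set_integrable_def;
            intro integrable_mult_indicator D integrable_level integrable_post[OF X])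
      then show "(LINT \<omega>:{\<omega> \<in> space M. ?S \<omega> \<in> C}|M. level k \<omega>) =
          (LINT \<omega>:{\<omega> \<in> space M. ?S \<omega> \<in> C}|M. level_prob M X Y k (fst (?S \<omega>)))"
        using zero[OF C] by simp
    qed
    then show ?L by simp
  }
qed

text \<open>Every event for Y is a finite disjoint union of levels, and both sides of the
  factorization are additive in it.\<close>

lemma cond_indep_iff_levels:
  "cond_indep_rv M borel Z (count_space {1..K}) Y borel X \<longleftrightarrow>
   (\<forall>A\<in>sets borel. \<forall>k\<in>{1..K}. AE \<omega> in M.
      real_cond_exp M (rv_sigma M borel X) (indicator {\<omega> \<in> space M. Z \<omega> \<in> A \<and> Y \<omega> = k}) \<omega> =
      real_cond_exp M (rv_sigma M borel X) (indicator {\<omega> \<in> space M. Z \<omega> \<in> A}) \<omega> *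
      real_cond_exp M (rv_sigma M borel X) (level k) \<omega>)"
proof
  let ?E = "real_cond_exp M (rv_sigma M borel X)"
  {
    assume ci: "cond_indep_rv M borel Z (count_space {1..K}) Y borel X"
    show "\<forall>A\<in>sets borel. \<forall>k\<in>{1..K}. AE \<omega> in M.
        ?E (indicator {\<omega> \<in> space M. Z \<omega> \<in> A \<and> Y \<omega> = k}) \<omega> =
        ?E (indicator {\<omega> \<in> space M. Z \<omega> \<in> A}) \<omega> * ?E (level k) \<omega>"
    proof (intro ballI)
      fix A :: "'z set" and k assume "A \<in> sets borel" "k \<in> {1..K}"
      then show "AE \<omega> in M. ?E (indicator {\<omega> \<in> space M. Z \<omega> \<in> A \<and> Y \<omega> = k}) \<omega> =
          ?E (indicator {\<omega> \<in> space M. Z \<omega> \<in> A}) \<omega> * ?E (level k) \<omega>"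
        using ci[unfolded cond_indep_rv_def event_prob_given_def, rule_format, of A "{k}"] by simp
    qed
  next
    assume lev: "\<forall>A\<in>sets borel. \<forall>k\<in>{1..K}. AE \<omega> in M.
        ?E (indicator {\<omega> \<in> space M. Z \<omega> \<in> A \<and> Y \<omega> = k}) \<omega> =
        ?E (indicator {\<omega> \<in> space M. Z \<omega> \<in> A}) \<omega> * ?E (level k) \<omega>"
    show "cond_indep_rv M borel Z (count_space {1..K}) Y borel X"
      unfolding cond_indep_rv_def event_prob_given_def
    proof (intro ballI)
      fix A :: "'z set" and B assume A [measurable]: "A \<in> sets borel" and "B \<in> sets (count_space {1..K})"
      then have B: "B \<subseteq> {1..K}" and finB: "finite B" by (auto intro: finite_subset)
      let ?Z = "\<lambda>k. indicat_real {\<omega> \<in> space M. Z \<omega> \<in> A \<and> Y \<omega> = k}"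
      have Z_sets [measurable]: "{\<omega> \<in> space M. Z \<omega> \<in> A \<and> Y \<omega> = k} \<in> sets M" for k
      proof -
        have "{\<omega> \<in> space M. Z \<omega> \<in> A \<and> Y \<omega> = k} = {\<omega> \<in> space M. Z \<omega> \<in> A} \<inter> {\<omega> \<in> space M. Y \<omega> = k}"
          by auto
        then show ?thesis by simp
      qed
      \<comment> \<open>Stated for a general condition Q because it is used twice: with Z in A, and
        with the trivial condition for Y alone.\<close>
      have split: "indicat_real {\<omega> \<in> space M. Q \<omega> \<and> Y \<omega> \<in> B} =
          (\<lambda>\<omega>. \<Sum>k\<in>B. indicat_real {\<omega> \<in> space M. Q \<omega> \<and> Y \<omega> = k} \<omega>)" for Q
      proof
        fix \<omega>
        have "(\<Sum>k\<in>B. indicat_real {\<omega> \<in> space M. Q \<omega> \<and> Y \<omega> = k} \<omega>) =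
            (\<Sum>k\<in>B. if Y \<omega> = k then indicat_real {\<omega> \<in> space M. Q \<omega>} \<omega> else 0)"
          by (intro sum.cong) (auto simp: indicator_def)
        then show "indicat_real {\<omega> \<in> space M. Q \<omega> \<and> Y \<omega> \<in> B} \<omega> =
            (\<Sum>k\<in>B. indicat_real {\<omega> \<in> space M. Q \<omega> \<and> Y \<omega> = k} \<omega>)"
          using finB by (auto simp: indicator_def)
      qed
      have "AE \<omega> in M. ?E (\<lambda>\<omega>. \<Sum>k\<in>B. ?Z k \<omega>) \<omega> = (\<Sum>k\<in>B. ?E (?Z k) \<omega>)"
        by (intro F.real_cond_exp_sum integrable_const_bound[of _ 1]) (auto simp: indicator_def)
      moreover have "AE \<omega> in M. ?E (\<lambda>\<omega>. \<Sum>k\<in>B. level k \<omega>) \<omega> = (\<Sum>k\<in>B. ?E (level k) \<omega>)"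
        by (intro F.real_cond_exp_sum integrable_level)
      moreover have "AE \<omega> in M. \<forall>k\<in>B. ?E (?Z k) \<omega> =
          ?E (indicator {\<omega> \<in> space M. Z \<omega> \<in> A}) \<omega> * ?E (level k) \<omega>"
        using lev A B finB by (intro AE_finite_allI) auto
      ultimately show "AE \<omega> in M. ?E (indicator {\<omega> \<in> space M. Z \<omega> \<in> A \<and> Y \<omega> \<in> B}) \<omega> =
          ?E (indicator {\<omega> \<in> space M. Z \<omega> \<in> A}) \<omega> * ?E (indicator {\<omega> \<in> space M. Y \<omega> \<in> B}) \<omega>"
        unfolding split[of "\<lambda>\<omega>. Z \<omega> \<in> A"] split[of "\<lambda>_. True", simplified]
        by eventually_elim (simp add: sum_distrib_left)
    qed
  }
qed

text \<open>Conditional independence and Q_(X,Z) = Q_X both amount to the rectangle identities; the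
  latter is the equality case of monotonicity with S = (X, Z) and the first projection.\<close>

lemma cond_indep_iff_psi_eq:
  "cond_indep_rv M borel Z (count_space {1..K}) Y borel X \<longleftrightarrow>
    psi M K (\<lambda>\<omega>. (X \<omega>, Z \<omega>)) Y = psi M K X Y"
proof -
  have "cond_indep_rv M borel Z (count_space {1..K}) Y borel X \<longleftrightarrow>
      (\<forall>k\<in>{1..K}. AE \<omega> in M. post (\<lambda>\<omega>. (X \<omega>, Z \<omega>)) k \<omega> = post X k \<omega>)"
    unfolding cond_indep_iff_levels post_pair_eq_iff_rectangles
    using cond_exp_level_factorizes_iff_rectangles by blast
  also have "\<dots> \<longleftrightarrow> psi M K (\<lambda>\<omega>. (X \<omega>, Z \<omega>)) Y = psi M K X Y"
    by (rule psi_eq_iff[OF X measurable_pair_borel fst_borel, symmetric]) simp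
  finally show ?thesis .
qed

end

end

section \<open>Assembly of the four claims\<close>

theorem theorem6:
  fixes M :: "'a measure"
    and K :: nat
    and X :: "'a \<Rightarrow> 'h::{metric_space, second_countable_topology}"
    and Z :: "'a \<Rightarrow> 'z::{metric_space, second_countable_topology}"
    and Y :: "'a \<Rightarrow> nat"
  assumes "prob_space M"
    and "K \<ge> 2"
    and "X \<in> M \<rightarrow>\<^sub>M borel"
    and "Z \<in> M \<rightarrow>\<^sub>M borel"
    and "Y \<in> M \<rightarrow>\<^sub>M count_space {1..K}"
    and "\<And>k. k \<in> {1..K} \<Longrightarrow> marginal_level_prob M Y k > 0"
    and "psi M K X Y \<noteq> 1"
  shows "(0 \<le> cond_psi M K Z Y X \<and> cond_psi M K Z Y X \<le> 1) \<and>
    (cond_psi M K Z Y X = 0 \<longleftrightarrow>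
       cond_indep_rv M borel Z (count_space {1..K}) Y borel X) \<and>
    (cond_psi M K Z Y X = 1 \<longleftrightarrow>
       (\<exists>h \<in> (borel :: ('h \<times> 'z) measure) \<rightarrow>\<^sub>M count_space {1..K}.
          AE \<omega> in M. Y \<omega> = h (X \<omega>, Z \<omega>))) \<and>
    (\<forall>l. bij_betw l {1..K} {1..K} \<longrightarrow>
       cond_psi M K Z Y X = cond_psi M K Z (l \<circ> Y) X)"
proof -
  interpret categorical_rv M K Y
    using assms(1,2,5,6) by (intro categorical_rv.intro categorical_rv_axioms.intro)
  note X = assms(3) and Z = assms(4)
  note XZ = measurable_pair_borel[OF X Z]
  let ?x = "psi M K X Y" and ?xz = "psi M K (\<lambda>\<omega>. (X \<omega>, Z \<omega>)) Y"
  have "?x < 1"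
    using psi_le_1[OF X] assms(7) by simp
  moreover have "?x \<le> ?xz"
    by (rule psi_mono[OF X XZ fst_borel[OF X Z]]) simp
  moreover have "?xz \<le> 1"
    by (rule psi_le_1[OF XZ])
  \<comment> \<open>With a positive denominator, the bounds say x <= xz <= 1, and the values 0 and 1
    of the quotient mean xz = x and xz = 1.\<close>
  ultimately have "0 \<le> cond_psi M K Z Y X \<and> cond_psi M K Z Y X \<le> 1"
    and zero: "cond_psi M K Z Y X = 0 \<longleftrightarrow> ?xz = ?x"
    and one: "cond_psi M K Z Y X = 1 \<longleftrightarrow> ?xz = 1"
    unfolding cond_psi_def by (auto simp: divide_le_eq)
  moreover have "\<forall>l. bij_betw l {1..K} {1..K} \<longrightarrow> cond_psi M K Z Y X = cond_psi M K Z (l \<circ> Y) X"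
    unfolding cond_psi_def using psi_relabel[OF _ X] psi_relabel[OF _ XZ] by simp
  ultimately show ?thesis
    using cond_indep_iff_psi_eq[OF X Z] psi_eq_1_iff_measurable_function[OF XZ] by blast
qed

end
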